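(* Let $X$ be a Banach space and let $\mathcal{T}=\{T_t\}_{t\in\Delta}$ be a $C_0$-semigroup on $X$ indexed by a complex sector $\Delta$. Then the following assertions are equivalent: (1) $\mathcal{T}$ admits a dense set of distributionally semi-irregular vectors; (2) $\mathcal{T}$ admits a residual set of distributionally irregular vectors; (3) the distributionally proximal relation $\mathrm{DProx}(\mathcal{T})$ is dense in $X\times X$ and $\mathcal{T}$ is distributionally sensitive; (4) for every sequence $(O_j)_j$ of nonempty open subsets of $X$, there exists a sequence $(K_j)_j$ of Cantor sets with $K_j\subset O_j$ such that $\bigcup_{j=1}^\infty K_j$ is a distributionally scrambled set. If in addition $X$ is separable, assertions (1), (2), (3) and (4) are also equivalent to: (5) $\mathcal{T}$ is densely distributionally chaotic.
   Context: A complex sector is $\Delta=\Delta(\alpha)=\{re^{i\theta}\in\mathbb{C}: r\ge 0,\ |\theta|\le\alpha\}$ for some $\alpha\in(0,\pi/2)$; it is a semigroup under addition. For $r>0$ put $\Delta_r=\{t\in\Delta:|t|<r\}$. With $\mu$ the (planar) Lebesgue measure, the upper density of a measurable $A\subset\Delta$ is $\overline{\mathrm{dens}}(A)=\limsup_{r\to\infty}\mu(A\cap\Delta_r)/\mu(\Delta_r)$. A family $\{T_t\}_{t\in\Delta}$ of continuous linear operators on a Banach space $X$ is a $C_0$-semigroup if $T_0=I$, $T_tT_s=T_{t+s}$ for all $t,s\in\Delta$, and $\lim_{t\to s}T_tx=T_sx$ in norm for all $s\in\Delta$, $x\in X$. A vector $x\in X$ is distributionally semi-irregular if there are measurable $A,B\subset\Delta$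 with $\overline{\mathrm{dens}}(A)=\overline{\mathrm{dens}}(B)=1$ such that $\lim_{t\in A,\,|t|\to\infty}\|T_tx\|=0$ and $\liminf_{t\in B,\,|t|\to\infty}\|T_tx\|>0$ (the value $+\infty$ is allowed); it is distributionally irregular if there are such $A,B$ with $\lim_{t\in A,\,|t|\to\infty}\|T_tx\|=0$ and $\lim_{t\in B,\,|t|\to\infty}\|T_tx\|=\infty$. $\mathrm{DProx}(\mathcal{T})$ is the set of pairs $(x,y)\in X\times X$ such that $\overline{\mathrm{dens}}(\{t\in\Delta:\|T_tx-T_ty\|<\varepsilon\})=1$ for every $\varepsilon>0$. $\mathcal{T}$ is distributionally sensitive if there is $\delta>0$ such that for every $x\in X$ and $\varepsilon>0$ there is $y\in X$ with $\|x-y\|<\varepsilon$ and $\overline{\mathrm{dens}}(\{t\in\Delta:\|T_tx-T_ty\|>\delta\})=1$. A pair $(x,y)$ is distributionally chaotic if there is $\delta>0$ such that $\overline{\mathrm{dens}}(\{t\in\Delta:\|T_tx-T_ty\|<\varepsilon\})=1$ for every $\varepsilon>0$ and $\overline{\mathrm{dens}}(\{t\in\Delta:\|T_tx-T_ty\|>\delta\})=1$. A distributionally scrambled set is an uncountable set $K\subset X$ such that any two distinct points of $K$ form a distributionally chaotic pair. $\mathcal{T}$ is densely distributionally chaotic if it admits a dense distributionally scrambled set. A subset of $X$ is residual if it contains a dense $G_\delta$ subset of $X$; a Cantor set is a subset homeomorphic to the Cantor ternary set. *)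

theory Defs
  imports "HOL-Analysis.Analysis"
begin

definition sector :: "real \<Rightarrow> complex set" where
  "sector \<alpha> = {complex_of_real r * cis \<theta> | r \<theta>. 0 \<le> r \<and> \<bar>\<theta>\<bar> \<le> \<alpha>}"

definition sector_cut :: "real \<Rightarrow> real \<Rightarrow> complex set" where
  "sector_cut \<alpha> r = {t \<in> sector \<alpha>. cmod t < r}"

definition upper_density :: "real \<Rightarrow> complex set \<Rightarrow> ereal" where
  "upper_density \<alpha> A =
     Limsup at_top (\<lambda>r. ereal (measure lebesgue (A \<inter> sector_cut \<alpha> r) / measure lebesgue (sector_cut \<alpha> r)))"

text \<open>
  The type class \<open>banach\<close> consists of real Banach spaces. A complex Banach space is also an
  instance of it, and its complex-linear continuous operators are in particular bounded linear
  over the reals. Values of \<open>T\<close> outside the sector are irrelevant.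
\<close>

definition C0_semigroup :: "real \<Rightarrow> (complex \<Rightarrow> 'a \<Rightarrow> 'a::banach) \<Rightarrow> bool" where
  "C0_semigroup \<alpha> T \<longleftrightarrow>
     (\<forall>t\<in>sector \<alpha>. bounded_linear (T t)) \<and>
     T 0 = id \<and>
     (\<forall>t\<in>sector \<alpha>. \<forall>s\<in>sector \<alpha>. T t \<circ> T s = T (t + s)) \<and>
     (\<forall>s\<in>sector \<alpha>. \<forall>x. ((\<lambda>t. T t x) \<longlongrightarrow> T s x) (at s within sector \<alpha>))"

text \<open>
  The filter \<open>inf at_infinity (principal A)\<close> expresses that \<open>t\<close> ranges over \<open>A\<close>
  and \<open>cmod t\<close> tends to infinity.
\<close>

definition dist_semi_irregular :: "real \<Rightarrow> (complex \<Rightarrow> 'a \<Rightarrow> 'a::banach) \<Rightarrow> 'a \<Rightarrow> bool" where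
  "dist_semi_irregular \<alpha> T x \<longleftrightarrow>
     (\<exists>A B. A \<in> sets lebesgue \<and> A \<subseteq> sector \<alpha> \<and> B \<in> sets lebesgue \<and> B \<subseteq> sector \<alpha> \<and>
        upper_density \<alpha> A = 1 \<and> upper_density \<alpha> B = 1 \<and>
        ((\<lambda>t. norm (T t x)) \<longlongrightarrow> 0) (inf at_infinity (principal A)) \<and>
        Liminf (inf at_infinity (principal B)) (\<lambda>t. ereal (norm (T t x))) > 0)"

definition dist_irregular :: "real \<Rightarrow> (complex \<Rightarrow> 'a \<Rightarrow> 'a::banach) \<Rightarrow> 'a \<Rightarrow> bool" where
  "dist_irregular \<alpha> T x \<longleftrightarrow>
     (\<exists>A B. A \<in> sets lebesgue \<and> A \<subseteq> sector \<alpha> \<and> B \<in> sets lebesgue \<and> B \<subseteq> sector \<alpha> \<and>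
        upper_density \<alpha> A = 1 \<and> upper_density \<alpha> B = 1 \<and>
        ((\<lambda>t. norm (T t x)) \<longlongrightarrow> 0) (inf at_infinity (principal A)) \<and>
        filterlim (\<lambda>t. norm (T t x)) at_top (inf at_infinity (principal B)))"

definition DProx :: "real \<Rightarrow> (complex \<Rightarrow> 'a \<Rightarrow> 'a::banach) \<Rightarrow> ('a \<times> 'a) set" where
  "DProx \<alpha> T =
     {(x, y). \<forall>\<epsilon>>0. upper_density \<alpha> {t \<in> sector \<alpha>. norm (T t x - T t y) < \<epsilon>} = 1}"

definition dist_sensitive :: "real \<Rightarrow> (complex \<Rightarrow> 'a \<Rightarrow> 'a::banach) \<Rightarrow> bool" where
  "dist_sensitive \<alpha> T \<longleftrightarrow>
     (\<exists>\<delta>>0. \<forall>x. \<forall>\<epsilon>>0. \<exists>y. norm (x - y) < \<epsilon> \<and>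
        upper_density \<alpha> {t \<in> sector \<alpha>. norm (T t x - T t y) > \<delta>} = 1)"

definition dist_chaotic_pair :: "real \<Rightarrow> (complex \<Rightarrow> 'a \<Rightarrow> 'a::banach) \<Rightarrow> 'a \<Rightarrow> 'a \<Rightarrow> bool" where
  "dist_chaotic_pair \<alpha> T x y \<longleftrightarrow>
     (\<exists>\<delta>>0. (\<forall>\<epsilon>>0. upper_density \<alpha> {t \<in> sector \<alpha>. norm (T t x - T t y) < \<epsilon>} = 1) \<and>
        upper_density \<alpha> {t \<in> sector \<alpha>. norm (T t x - T t y) > \<delta>} = 1)"

definition dist_scrambled :: "real \<Rightarrow> (complex \<Rightarrow> 'a \<Rightarrow> 'a::banach) \<Rightarrow> 'a set \<Rightarrow> bool" where
  "dist_scrambled \<alpha> T K \<longleftrightarrow>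
     uncountable K \<and> (\<forall>x\<in>K. \<forall>y\<in>K. x \<noteq> y \<longrightarrow> dist_chaotic_pair \<alpha> T x y)"

definition densely_dist_chaotic :: "real \<Rightarrow> (complex \<Rightarrow> 'a \<Rightarrow> 'a::banach) \<Rightarrow> bool" where
  "densely_dist_chaotic \<alpha> T \<longleftrightarrow> (\<exists>K. closure K = UNIV \<and> dist_scrambled \<alpha> T K)"

definition residual :: "'a::topological_space set \<Rightarrow> bool" where
  "residual S \<longleftrightarrow> (\<exists>G\<subseteq>S. gdelta G \<and> closure G = UNIV)"

primrec cantor_stage :: "nat \<Rightarrow> real set" where
  "cantor_stage 0 = {0..1}"
| "cantor_stage (Suc n) = (\<lambda>x. x / 3) ` cantor_stage n \<union> (\<lambda>x. (x + 2) / 3) ` cantor_stage n"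

definition cantor_ternary :: "real set" where
  "cantor_ternary = (\<Inter>n. cantor_stage n)"

definition cantor_set :: "'a::topological_space set \<Rightarrow> bool" where
  "cantor_set K \<longleftrightarrow> K homeomorphic cantor_ternary"

end

theory Submission
  imports Defs
begin

text \<open>
  All assertions are equivalent to the distributionally irregular vectors containing a countable
  intersection of dense open sets. Given a semi-irregular vector \<open>x\<close>, the points \<open>T s x\<close>
  of its orbit yield arbitrarily small vectors whose orbits all exceed one fixed \<open>\<delta>\<close> with
  upper density one; so do, by scaling, arbitrarily small vectors \<open>z\<close> for any given bound \<open>2 * c\<close>.
  Among the vectors \<open>x + j *\<^sub>R z\<close> with \<open>j < N\<close>, at most one can have norm at most \<open>c\<close> at any time where
  the orbit of \<open>z\<close> exceeds \<open>2 * c\<close>, so one of them exceeds \<open>c\<close> on all but a fraction of about \<open>1 / N\<close>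
  of some large sector. This gives density of the open sets. Baire's theorem then provides residual
  irregularity, and a construction in the style of Mycielski provides the Cantor sets.
  The way back from scrambled sets uses differences of a point near \<open>u\<close> and a point near \<open>0\<close>.
\<close>

section \<open>Cantor sets in residual sets\<close>

text \<open>By linearity, each notion about a pair \<open>(x, y)\<close> is a statement about the
  single vector \<open>x - y\<close>. The obstacle is that two sets of upper density one can be
  disjoint, since the radii at which they fill the sector may differ. So the times at which the
  orbit of a small \<open>z\<close> is large cannot be matched with good times of \<open>x\<close>,
  and which multiple of \<open>z\<close> fails depends on the time. Hence many multiples are tried
  at once, and one is selected by averaging over a single cut of the sector. Upper density one says
  that on arbitrarily large cuts the complement is a small fraction. For one fixed cut this survives
  small changes of the vector, up to a slight loss in the level, because the operators
  \<open>T t\<close> with \<open>t\<close> in a bounded cut are uniformly bounded. This is what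
  produces open sets, and countably many such conditions give irregularity. Limits along the sets
  \<open>A\<close> and \<open>B\<close> are recovered from level sets by a diagonal choice of
  radii.\<close>

lemma closure_INT_open_dense:
  fixes W :: "'i \<Rightarrow> 'a::complete_space set"
  assumes "countable I" and "\<And>i. i \<in> I \<Longrightarrow> open (W i)" and "\<And>i. i \<in> I \<Longrightarrow> closure (W i) = UNIV"
  shows "closure (\<Inter>i\<in>I. W i) = UNIV"
proof -
  have "(euclidean :: 'a topology) closure_of \<Inter>(W ` I) = topspace euclidean"
    by (rule Baire_category) (use assms completely_metrizable_space_euclidean in auto)
  then show ?thesis
    by simp
qed

lemma dense_meets_open: "closure S = UNIV \<Longrightarrow> open U \<Longrightarrow> U \<noteq> {} \<Longrightarrow> \<exists>x\<in>U. x \<in> S"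
  using open_Int_closure_eq_empty[of U S] by auto

text \<open>Each condition says that \<open>w\<close> lies in a translate of \<open>W n\<close> or
  of its reflection, again open and dense; there are countably many of them, so Baire applies. Both
  signs are requested because the \<open>W n\<close> need not be symmetric.\<close>

lemma exists_shifts_in_residual:
  fixes W :: "nat \<Rightarrow> 'a::banach set"
  assumes "\<And>n. open (W n)" and "\<And>n. closure (W n) = UNIV" and "finite F" and "open U" and "U \<noteq> {}"
  shows "\<exists>w\<in>U. \<forall>f\<in>F. f + w \<in> (\<Inter>n. W n) \<and> f - w \<in> (\<Inter>n. W n)"
proof -
  define V where "V = (\<lambda>(f, n). (+) (- f) ` W n)"
  define V' where "V' = (\<lambda>(f, n). (-) f ` W n)"
  have "closure (\<Inter>p\<in>F \<times> UNIV. V p \<inter> V' p) = UNIV"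
  proof (rule closure_INT_open_dense)
    fix p assume "p \<in> F \<times> (UNIV :: nat set)"
    obtain f n where p: "p = (f, n)"
      by (cases p)
    have m: "(-) f ` S = (+) f ` uminus ` S" for S
      by (auto simp: image_image)
    have o: "open (V p)" "open (V' p)"
      unfolding p V_def V'_def prod.case m
      by (intro open_translation open_negations assms)+
    have "uminus ` closure (W n) \<subseteq> closure (uminus ` W n)"
      by (intro closure_bounded_linear_image_subset bounded_linear_minus bounded_linear_ident)
    then have "closure (uminus ` W n) = UNIV"
      using assms(2)[of n] by (simp add: surj_uminus top.extremum_unique)
    then have c: "closure (V p) = UNIV" "closure (V' p) = UNIV"
      unfolding p V_def V'_def prod.case m closure_translation assms(2)
      by (simp_all add: surj_plus)
    show "open (V p \<inter> V' p)"
      using o by auto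
    show "closure (V p \<inter> V' p) = UNIV"
    proof -
      have "closure (V p \<inter> V' p) = closure (V p \<inter> closure (V' p))"
        by (metis c o(1) closure_closure closure_mono open_Int_closure_subset Int_lower1
            Int_UNIV_right subset_antisym top_greatest)
      then show ?thesis
        using c by auto
    qed
  qed (use assms in \<open>auto intro: countable_finite\<close>)
  from dense_meets_open[OF this assms(4,5)]
  obtain w where w: "w \<in> U" "\<And>f n. f \<in> F \<Longrightarrow> w \<in> V (f, n) \<inter> V' (f, n)"
    by blast
  have "f + w \<in> W n \<and> f - w \<in> W n" if "f \<in> F" for f n
  proof -
    have "w \<in> (+) (- f) ` W n" "w \<in> (-) f ` W n"
      using w(2)[OF that, of n] unfolding V_def V'_def by simp_all
    then obtain x y where *: "x \<in> W n" "w = - f + x" "y \<in> W n" "w = f - y"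
      by blast
    have "f + w = x"
      by (simp add: *(2))
    moreover have "f - w = y"
      by (simp add: *(4))
    ultimately show ?thesis
      using * by simp
  qed
  with w(1) show ?thesis
    by auto
qed

section \<open>The ternary Cantor set and its binary digits\<close>

definition cantor_shift :: "real \<Rightarrow> real" where
  "cantor_shift x = (if x \<le> 1/2 then 3 * x else 3 * x - 2)"

text \<open>\<open>cantor_shift\<close> inverts the two contractions that build
  \<open>cantor_stage\<close>; for a point of the Cantor set, its itinerary records half of each
  ternary digit 0 or 2. The threshold 1/2 lies in the removed middle third, which makes the digits
  continuous there.\<close>

definition cantor_digit :: "nat \<Rightarrow> real \<Rightarrow> real" where
  "cantor_digit k x = (if (cantor_shift ^^ k) x \<le> 1/2 then 0 else 1)"

lemma cantor_stage_subset: "cantor_stage n \<subseteq> {0..1}"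
  by (induction n) force+

lemma compact_cantor_ternary: "compact cantor_ternary"
proof -
  have "compact (cantor_stage n)" for n
    by (induction n) (auto intro!: compact_Un compact_continuous_image continuous_intros)
  then show ?thesis
    unfolding cantor_ternary_def by (intro compact_Inter) auto
qed

lemma cantor_ternary_subset: "cantor_ternary \<subseteq> {..1/3} \<union> {2/3..}"
proof -
  have "cantor_stage (Suc 0) \<subseteq> {..1/3} \<union> {2/3..}"
    by auto
  then show ?thesis
    unfolding cantor_ternary_def by blast
qed

lemma cantor_shift_in: "x \<in> cantor_ternary \<Longrightarrow> cantor_shift x \<in> cantor_ternary"
proof -
  assume x: "x \<in> cantor_ternary"
  have "cantor_shift x \<in> cantor_stage n" for n
  proof -
    have "x \<in> cantor_stage (Suc n)"
      using x unfolding cantor_ternary_def by blast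
    then consider y where "y \<in> cantor_stage n" "x = y / 3"
      | y where "y \<in> cantor_stage n" "x = (y + 2) / 3"
      by auto
    then show ?thesis
    proof cases
      case 1
      then have "y \<le> 1"
        using cantor_stage_subset[of n] by auto
      with 1 show ?thesis
        by (simp add: cantor_shift_def mult.commute)
    next
      case 2
      then have "y \<ge> 0"
        using cantor_stage_subset[of n] by auto
      with 2 have "cantor_shift x = y"
        by (simp add: cantor_shift_def)
      with 2 show ?thesis
        by simp
    qed
  qed
  then show ?thesis
    by (auto simp: cantor_ternary_def)
qed

lemma cantor_shift_funpow_in: "x \<in> cantor_ternary \<Longrightarrow> (cantor_shift ^^ k) x \<in> cantor_ternary"
  by (induction k) (auto simp: cantor_shift_in)

text \<open>The jump at 1/2 falls into the gap between 1/3 and 2/3, so \<open>f\<close> and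
  \<open>g\<close> are glued along two separated closed sets and may disagree.\<close>

lemma continuous_on_if_cantor:
  fixes f g :: "real \<Rightarrow> real"
  assumes "continuous_on UNIV f" "continuous_on UNIV g"
  shows "continuous_on cantor_ternary (\<lambda>x. if x \<le> 1/2 then f x else g x)"
proof -
  have "continuous_on ({..1/3} \<union> {2/3..}) (\<lambda>x. if x \<le> 1/2 then f x else g x)"
    by (rule continuous_on_cases) (use assms in \<open>auto intro: continuous_on_subset\<close>)
  then show ?thesis
    using cantor_ternary_subset continuous_on_subset by blast
qed

lemma continuous_on_cantor_digit: "continuous_on cantor_ternary (cantor_digit k)"
proof -
  have s: "continuous_on cantor_ternary cantor_shift"
    unfolding cantor_shift_def[abs_def]
    by (rule continuous_on_if_cantor) (auto intro!: continuous_intros)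
  have sk: "continuous_on cantor_ternary (cantor_shift ^^ k)"
  proof (induction k)
    case (Suc k)
    then show ?case
      unfolding funpow.simps
      by (rule continuous_on_compose) (auto intro: continuous_on_subset[OF s] cantor_shift_funpow_in)
  qed (auto simp: id_def)
  have "continuous_on cantor_ternary ((\<lambda>x. if x \<le> 1/2 then 0 else 1::real) \<circ> (cantor_shift ^^ k))"
    by (intro continuous_on_compose sk continuous_on_subset[OF continuous_on_if_cantor])
      (auto simp: cantor_shift_funpow_in)
  then show ?thesis
    by (simp add: cantor_digit_def[abs_def] o_def)
qed

text \<open>While the digits agree, both points use the same branch of the shift, which triples
  their difference; but both stay in the unit interval.\<close>

lemma cantor_digit_separates:
  assumes "x \<in> cantor_ternary" "y \<in> cantor_ternary" "\<And>k. cantor_digit k x = cantor_digit k y"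
  shows "x = y"
proof (rule ccontr)
  assume ne: "x \<noteq> y"
  have *: "(cantor_shift ^^ k) x - (cantor_shift ^^ k) y = 3 ^ k * (x - y)" for k
  proof (induction k)
    case (Suc k)
    have "cantor_shift s - cantor_shift t = 3 * (s - t)" if "s \<le> 1/2 \<longleftrightarrow> t \<le> 1/2" for s t
      using that by (simp add: cantor_shift_def)
    moreover have "(cantor_shift ^^ k) x \<le> 1/2 \<longleftrightarrow> (cantor_shift ^^ k) y \<le> 1/2"
      using assms(3)[of k] by (simp add: cantor_digit_def split: if_splits)
    ultimately show ?case
      using Suc by simp
  qed auto
  have C: "u \<in> {0..1}" if "u \<in> cantor_ternary" for u
    using that cantor_stage_subset[of 0] unfolding cantor_ternary_def by blast
  have le: "\<bar>3 ^ k * (x - y)\<bar> \<le> 1" for k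
    using C[OF cantor_shift_funpow_in[OF assms(1), of k]]
      C[OF cantor_shift_funpow_in[OF assms(2), of k]]
    unfolding *[symmetric] by auto
  obtain k where "1 / \<bar>x - y\<bar> < 3 ^ k"
    using real_arch_pow[of 3 "1 / \<bar>x - y\<bar>"] by auto
  with ne have "1 < 3 ^ k * \<bar>x - y\<bar>"
    by (simp add: field_simps)
  with le[of k] show False
    by (simp add: abs_mult)
qed

text \<open>
  The Cantor sets consist of the sums \<open>a j + (\<Sum>k\<ge>j. d k *\<^sub>R z k)\<close> over binary sequences \<open>d\<close>.
  Differences of their points are limits of combinations of the \<open>a k\<close> and \<open>z k\<close> with
  coefficients \<open>-1\<close>, \<open>0\<close>, \<open>1\<close>. All nontrivial finite combinations are made to lie in the dense
  \<open>G\<^sub>\<delta>\<close> set, and each \<open>z k\<close> is chosen so small that adding the tail does not leave \<open>W m\<close>.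
\<close>

lemma mycielski_step:
  fixes W :: "nat \<Rightarrow> 'a::banach set"
  assumes W: "\<And>n. open (W n)" "\<And>n. closure (W n) = UNIV"
    and U: "open U" "U \<noteq> {}"
    and F: "finite F" "F \<subseteq> insert 0 (\<Inter>n. W n)" and "e > 0"
  shows "\<exists>a z e'. 0 < e' \<and> e' \<le> e / 2 \<and> cball a (2 * e') \<subseteq> U \<and> norm z \<le> e' \<and>
    (\<forall>f\<in>F - {0}. \<forall>m\<le>n. ball f (3 * e') \<subseteq> W m) \<and>
    (\<forall>f\<in>F. \<forall>b\<in>{-1,0,1}. \<forall>c\<in>{-1,0,1}.
      f = 0 \<and> b = 0 \<and> c = 0 \<or> f + (b *\<^sub>R a + c *\<^sub>R z) \<in> (\<Inter>n. W n))"
proof -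
  let ?G = "\<Inter>n. W n"
  obtain a where a: "a \<in> U" "\<forall>f\<in>F. f + a \<in> ?G \<and> f - a \<in> ?G"
    using exists_shifts_in_residual[OF W F(1) U] by (rule bexE)
  obtain r where r: "r > 0" "ball a r \<subseteq> U"
    using a(1) U openE by blast
  have "\<exists>s>0. \<forall>m\<le>n. ball f s \<subseteq> W m" if "f \<in> F - {0}" for f
  proof -
    have "open (\<Inter>m\<le>n. W m)" "f \<in> (\<Inter>m\<le>n. W m)"
      using W that F(2) by auto
    then obtain s where "s > 0" "ball f s \<subseteq> (\<Inter>m\<le>n. W m)"
      by (rule openE)
    then show ?thesis
      by blast
  qed
  then obtain s where s: "\<And>f. f \<in> F - {0} \<Longrightarrow> s f > 0 \<and> (\<forall>m\<le>n. ball f (s f) \<subseteq> W m)"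
    by metis
  \<comment> \<open>\<open>e / 2\<close> gives geometric decay, \<open>r / 3\<close> fits
    \<open>cball a (2 * e')\<close> into \<open>U\<close>, and \<open>s f / 3\<close> fits
    \<open>ball f (3 * e')\<close> into \<open>W m\<close>. The factors anticipate a later tail of
    norm at most \<open>2 * e'\<close>, which must end strictly inside an open ball.\<close>
  define e' where "e' = Min ({e / 2, r / 3} \<union> (\<lambda>f. s f / 3) ` (F - {0}))"
  have "e' > 0"
    unfolding e'_def using F(1) s r(1) \<open>e > 0\<close> by (subst Min_gr_iff) auto
  moreover have "e' \<le> x" if "x \<in> {e / 2, r / 3} \<union> (\<lambda>f. s f / 3) ` (F - {0})" for x
    unfolding e'_def by (rule Min_le) (use F(1) that in auto)
  ultimately have e': "e' > 0" "e' \<le> e / 2" "e' \<le> r / 3" "\<And>f. f \<in> F - {0} \<Longrightarrow> e' \<le> s f / 3"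
    by blast+
  \<comment> \<open>\<open>z\<close> is chosen after \<open>a\<close>, so its shifts are imposed on
    all combinations that already involve \<open>a\<close>.\<close>
  define F' where "F' = (\<Union>f\<in>F. \<Union>b\<in>{-1,0,1::real}. {f + b *\<^sub>R a})"
  have "finite F'"
    unfolding F'_def using F(1) by auto
  then have "\<exists>z\<in>ball 0 e'. \<forall>f\<in>F'. f + z \<in> ?G \<and> f - z \<in> ?G"
    using e'(1) by (intro exists_shifts_in_residual W) auto
  then obtain z where z: "z \<in> ball 0 e'" "\<forall>f\<in>F'. f + z \<in> ?G \<and> f - z \<in> ?G"
    by (rule bexE)
  have "f = 0 \<and> b = 0 \<and> c = 0 \<or> f + (b *\<^sub>R a + c *\<^sub>R z) \<in> ?G"
    if "f \<in> F" and b: "b \<in> {-1,0,1}" and c: "c \<in> {-1,0,1}" for f b c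
  proof (cases "c = 0")
    case True
    then show ?thesis
      using a(2)[rule_format, OF that(1)] F(2) that(1) b by auto
  next
    case False
    have "f + b *\<^sub>R a \<in> F'"
      using that by (auto simp: F'_def)
    from z(2)[rule_format, OF this] show ?thesis
      using False c by (auto simp: algebra_simps)
  qed
  moreover have "ball f (3 * e') \<subseteq> W m" if "f \<in> F - {0}" "m \<le> n" for f m
    using s[OF that(1)] e'(4)[OF that(1)] that(2) subset_ball[of "3 * e'" "s f" f] by fastforce
  moreover have "cball a (2 * e') \<subseteq> U"
  proof -
    have "cball a (2 * e') \<subseteq> ball a r"
      using e'(1,3) by auto
    then show ?thesis
      using r(2) by blast
  qed
  ultimately show ?thesis
    using e' z(1) by (intro exI[of _ a] exI[of _ z] exI[of _ e']) auto
qed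

text \<open>Dependent choice carries the finite set \<open>F\<close> of all combinations formed so
  far. The radius \<open>e n\<close> is fixed when the combinations with indices below
  \<open>n\<close> are known, and protects these; those involving \<open>a n\<close> and
  \<open>z n\<close> are protected from the next step on. Since 0 is not in the intersection, being
  0 singles out the trivial combination.\<close>

lemma mycielski_sequences:
  fixes W :: "nat \<Rightarrow> 'a::banach set"
  assumes W: "\<And>n. open (W n)" "\<And>n. closure (W n) = UNIV" "0 \<notin> (\<Inter>n. W n)"
    and U: "\<And>j. open (U j)" "\<And>j. U j \<noteq> {}"
  shows "\<exists>a z e. (\<forall>n. 0 < e n \<and> e (Suc n) \<le> e n / 2 \<and> cball (a n) (2 * e n) \<subseteq> U n \<and> norm (z n) \<le> e n) \<and>
    (\<forall>n m b c. (\<forall>k. b k \<in> {-1,0,1}) \<longrightarrow> (\<forall>k. c k \<in> {-1,0,1}) \<longrightarrow> (\<exists>k<n. b k \<noteq> 0 \<or> c k \<noteq> 0) \<longrightarrow>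
      m \<le> n \<longrightarrow> ball (\<Sum>k<n. b k *\<^sub>R a k + c k *\<^sub>R z k) (3 * e n) \<subseteq> W m)"
proof -
  let ?G = "\<Inter>n. W n"
  define ext where "ext F a z = (\<Union>f\<in>F. \<Union>b\<in>{-1,0,1::real}. \<Union>c\<in>{-1,0,1::real}. {f + (b *\<^sub>R a + c *\<^sub>R z)})"
    for F and a z :: 'a
  define P where "P = (\<lambda>(n::nat) (F, a::'a, z::'a, e::real). finite F \<and> 0 \<in> F \<and> F \<subseteq> insert 0 ?G \<and> e > 0)"
  define Q where "Q = (\<lambda>n (F, a::'a, z::'a, e::real) (F', a, z, e').
    e' \<le> e / 2 \<and> cball a (2 * e') \<subseteq> U n \<and> norm z \<le> e' \<and>
    (\<forall>f\<in>F - {0}. \<forall>m\<le>n. ball f (3 * e') \<subseteq> W m) \<and> F' = ext F a z \<and>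
    (\<forall>f\<in>F. \<forall>b\<in>{-1,0,1}. \<forall>c\<in>{-1,0,1}.
      f = 0 \<and> b = 0 \<and> c = 0 \<or> f + (b *\<^sub>R a + c *\<^sub>R z) \<in> ?G))"
  have "\<exists>f. \<forall>n. P n (f n) \<and> Q n (f n) (f (Suc n))"
  proof (rule dependent_nat_choice)
    show "\<exists>x. P 0 x"
      by (rule exI[of _ "({0}, 0, 0, 1)"]) (auto simp: P_def)
  next
    fix x n assume x: "P n x"
    obtain F a0 z0 e where [simp]: "x = (F, a0, z0, e)"
      by (cases x)
    have F: "finite F" "F \<subseteq> insert 0 ?G" "e > 0" "0 \<in> F"
      using x by (auto simp: P_def)
    obtain a z e' where *: "0 < e'" "e' \<le> e / 2" "cball a (2 * e') \<subseteq> U n" "norm z \<le> e'"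
      "\<forall>f\<in>F - {0}. \<forall>m\<le>n. ball f (3 * e') \<subseteq> W m"
      "\<forall>f\<in>F. \<forall>b\<in>{-1,0,1}. \<forall>c\<in>{-1,0,1}.
        f = 0 \<and> b = 0 \<and> c = 0 \<or> f + (b *\<^sub>R a + c *\<^sub>R z) \<in> ?G"
      using mycielski_step[OF W(1,2) U(1,2) F(1-3), of n n] by (elim exE conjE)
    have "ext F a z \<subseteq> insert 0 ?G"
    proof
      fix g assume "g \<in> ext F a z"
      then obtain f b c where g: "f \<in> F" "b \<in> {-1,0,1}" "c \<in> {-1,0,1}" "g = f + (b *\<^sub>R a + c *\<^sub>R z)"
        unfolding ext_def by blast
      then show "g \<in> insert 0 ?G"
        using *(6)[rule_format, OF g(1-3)] by (cases "f = 0 \<and> b = 0 \<and> c = 0") auto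
    qed
    moreover have "finite (ext F a z)"
      unfolding ext_def using F(1) by blast
    moreover have "0 \<in> ext F a z"
      unfolding ext_def using F(4) by force
    ultimately have "P (Suc n) (ext F a z, a, z, e')" "Q n x (ext F a z, a, z, e')"
      using * unfolding P_def Q_def by auto
    then show "\<exists>y. P (Suc n) y \<and> Q n x y"
      by blast
  qed
  then obtain st where st: "\<And>n. P n (st n)" "\<And>n. Q n (st n) (st (Suc n))"
    by blast
  \<comment> \<open>State \<open>Suc n\<close> stores what step \<open>n\<close> chooses, hence the
    shifted index for \<open>a\<close>, \<open>z\<close> and \<open>e\<close>; the vectors
    \<open>a\<close> and \<open>z\<close> of state 0 are placeholders.\<close>
  define F where "F n = fst (st n)" for n
  define a where "a n = fst (snd (st (Suc n)))" for n
  define z where "z n = fst (snd (snd (st (Suc n))))" for n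
  define e where "e n = snd (snd (snd (st (Suc n))))" for n
  have P: "finite (F n)" "0 \<in> F n" "F n \<subseteq> insert 0 ?G" "e n > 0" for n
    using st(1)[of n] st(1)[of "Suc n"] by (auto simp: P_def F_def e_def split: prod.splits)
  have eq: "st (Suc n) = (F (Suc n), a n, z n, e n)" for n
    by (simp add: F_def a_def z_def e_def)
  have Q: "cball (a n) (2 * e n) \<subseteq> U n" "norm (z n) \<le> e n"
    "\<And>f m. f \<in> F n - {0} \<Longrightarrow> m \<le> n \<Longrightarrow> ball f (3 * e n) \<subseteq> W m"
    "F (Suc n) = ext (F n) (a n) (z n)"
    "\<And>f b c. f \<in> F n \<Longrightarrow> b \<in> {-1,0,1} \<Longrightarrow> c \<in> {-1,0,1} \<Longrightarrow>
      f = 0 \<and> b = 0 \<and> c = 0 \<or> f + (b *\<^sub>R a n + c *\<^sub>R z n) \<in> ?G" for n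
    using st(2)[of n] unfolding eq by (auto simp: Q_def F_def split: prod.splits)
  have e: "e (Suc n) \<le> e n / 2" for n
    using st(2)[of "Suc n"] unfolding eq by (auto simp: Q_def)
  have "ball (\<Sum>k<n. b k *\<^sub>R a k + c k *\<^sub>R z k) (3 * e n) \<subseteq> W m"
    if bc: "\<forall>k. b k \<in> {-1,0,1}" "\<forall>k. c k \<in> {-1,0,1}"
      and nt: "\<exists>k<n. b k \<noteq> 0 \<or> c k \<noteq> 0" and "m \<le> n" for n m b c
  proof -
    have b: "b k \<in> {-1,0,1}" and c: "c k \<in> {-1,0,1}" for k
      using bc by blast+
    let ?s = "\<lambda>n. \<Sum>k<n. b k *\<^sub>R a k + c k *\<^sub>R z k"
    have F: "?s n \<in> F n" for n
    proof (induction n)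
      case (Suc n)
      then show ?case
        unfolding Q(4) ext_def sum.lessThan_Suc using b[of n] c[of n] by blast
    qed (use P in simp)
    have "?s n \<in> ?G"
      using nt
    proof (induction n)
      case (Suc n)
      have "?s n = 0 \<and> b n = 0 \<and> c n = 0 \<or> ?s (Suc n) \<in> ?G"
        using Q(5)[OF F b c] by simp
      \<comment> \<open>If both coefficients at \<open>n\<close> vanish, a nonzero one occurs
        earlier; then the induction hypothesis puts \<open>?s n\<close> into the intersection, which
        excludes 0.\<close>
      moreover have "\<not> (?s n = 0 \<and> b n = 0 \<and> c n = 0)"
        using Suc W(3) by (metis less_antisym)
      ultimately show ?case
        by blast
    qed auto
    with W(3) have "?s n \<noteq> 0"
      by metis
    with F Q(3) \<open>m \<le> n\<close> show "ball (?s n) (3 * e n) \<subseteq> W m"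
      by blast
  qed
  moreover have "\<forall>n. 0 < e n \<and> e (Suc n) \<le> e n / 2 \<and> cball (a n) (2 * e n) \<subseteq> U n \<and> norm (z n) \<le> e n"
    by (intro allI conjI P Q e)
  ultimately show ?thesis
    by (intro exI[of _ a] exI[of _ z] exI[of _ e] conjI allI impI) simp_all
qed

lemma sums_geometric_tail:
  fixes z :: "nat \<Rightarrow> 'a::banach" and e c :: "nat \<Rightarrow> real"
  assumes "\<And>n. 0 < e n" "\<And>n. e (Suc n) \<le> e n / 2" "\<And>n. norm (z n) \<le> e n" "\<And>k. \<bar>c k\<bar> \<le> 1"
  shows "summable (\<lambda>k. norm (c (k + n) *\<^sub>R z (k + n)))"
    and "norm (\<Sum>k. c (k + n) *\<^sub>R z (k + n)) \<le> 2 * e n"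
proof -
  have b: "e (k + n) \<le> e n * (1 / 2) ^ k" for k
  proof (induction k)
    case (Suc k)
    then show ?case
      using assms(2)[of "k + n"] by simp
  qed simp
  have le: "norm (c (k + n) *\<^sub>R z (k + n)) \<le> e n * (1 / 2) ^ k" for k
  proof -
    have "norm (c (k + n) *\<^sub>R z (k + n)) \<le> 1 * e (k + n)"
      unfolding norm_scaleR by (intro mult_mono assms) auto
    then show ?thesis
      using b[of k] by simp
  qed
  have s: "summable (\<lambda>k. e n * (1 / 2) ^ k)"
    by (intro summable_mult summable_geometric) simp
  show "summable (\<lambda>k. norm (c (k + n) *\<^sub>R z (k + n)))"
    by (rule summable_comparison_test[OF _ s]) (use le in auto)
  have "norm (\<Sum>k. c (k + n) *\<^sub>R z (k + n)) \<le> (\<Sum>k. e n * (1 / 2) ^ k)"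
    by (rule norm_suminf_le[OF le s])
  also have "\<dots> = 2 * e n"
    by (subst suminf_mult) (auto intro: summable_geometric simp: suminf_geometric)
  finally show "norm (\<Sum>k. c (k + n) *\<^sub>R z (k + n)) \<le> 2 * e n" .
qed

text \<open>A difference of two points has \<open>a\<close>-part \<open>a i - a j\<close>, and its
  coefficients at the \<open>z k\<close> are differences of digits. If the sets or some digit
  differ, the combination is nontrivial; its partial sums lie in \<open>W m\<close> with margin
  \<open>3 * e n\<close>, while the tail moves them by at most \<open>2 * e n\<close>. As 0 is
  excluded, this also makes the parametrisations injective, hence homeomorphisms onto their images
  by compactness.\<close>

theorem mycielski_differences:
  fixes W U :: "nat \<Rightarrow> 'a::banach set"
  assumes W: "\<And>n. open (W n)" "\<And>n. closure (W n) = UNIV" "0 \<notin> (\<Inter>n. W n)"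
    and U: "\<And>j. open (U j)" "\<And>j. U j \<noteq> {}"
  shows "\<exists>K. (\<forall>j. cantor_set (K j) \<and> K j \<subseteq> U j) \<and>
    (\<forall>x\<in>\<Union>j. K j. \<forall>y\<in>\<Union>j. K j. x \<noteq> y \<longrightarrow> x - y \<in> (\<Inter>n. W n))"
proof -
  obtain a z e where
    seqs: "\<forall>n. 0 < e n \<and> e (Suc n) \<le> e n / 2 \<and> cball (a n) (2 * e n) \<subseteq> U n \<and> norm (z n) \<le> e n"
    and comb: "\<forall>n m b c. (\<forall>k. b k \<in> {-1,0,1}) \<longrightarrow> (\<forall>k. c k \<in> {-1,0,1}) \<longrightarrow>
      (\<exists>k<n. b k \<noteq> 0 \<or> c k \<noteq> 0) \<longrightarrow>
      m \<le> n \<longrightarrow> ball (\<Sum>k<n. b k *\<^sub>R a k + c k *\<^sub>R z k) (3 * e n) \<subseteq> W m"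
    using mycielski_sequences[where W = W and U = U, OF W U] by (elim exE conjE)
  have e: "\<And>n. 0 < e n" "\<And>n. e (Suc n) \<le> e n / 2" and a: "\<And>n. cball (a n) (2 * e n) \<subseteq> U n"
    and z: "\<And>n. norm (z n) \<le> e n"
    using seqs by blast+
  have tail: "summable (\<lambda>k. norm (c (k + n) *\<^sub>R z (k + n)))"
    "norm (\<Sum>k. c (k + n) *\<^sub>R z (k + n)) \<le> 2 * e n" if "\<And>k. \<bar>c k\<bar> \<le> 1" for c n
    using sums_geometric_tail[where e = e and z = z and c = c and n = n] e z that by auto
  have limit_in: "(\<Sum>k<N. b k *\<^sub>R a k) + (\<Sum>k. c k *\<^sub>R z k) \<in> (\<Inter>n. W n)"
    if b: "\<And>k. b k \<in> {-1,0,1}" and c: "\<And>k. c k \<in> {-1,0,1}"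
      and N: "\<And>k. k \<ge> N \<Longrightarrow> b k = 0" and nt: "b l \<noteq> 0 \<or> c l \<noteq> 0" for b c N l
  proof
    fix m
    \<comment> \<open>Large enough to contain all \<open>a\<close>-terms, to control
      \<open>W m\<close>, and to include the index \<open>l\<close> of a nonzero
      coefficient.\<close>
    define n where "n = N + m + Suc l"
    have c1: "\<bar>c k\<bar> \<le> 1" for k
      using c[of k] by auto
    have s: "summable (\<lambda>k. c k *\<^sub>R z k)"
      using tail(1)[of c 0] c1 by (auto intro: summable_norm_cancel)
    have "(\<Sum>k<N. b k *\<^sub>R a k) = (\<Sum>k<n. b k *\<^sub>R a k)"
      by (rule sum.mono_neutral_left) (auto simp: n_def N)
    then have "(\<Sum>k<N. b k *\<^sub>R a k) + (\<Sum>k. c k *\<^sub>R z k) =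
        (\<Sum>k<n. b k *\<^sub>R a k + c k *\<^sub>R z k) + (\<Sum>k. c (k + n) *\<^sub>R z (k + n))"
      using suminf_split_initial_segment[OF s, of n] by (simp add: sum.distrib algebra_simps)
    also have "\<dots> \<in> ball (\<Sum>k<n. b k *\<^sub>R a k + c k *\<^sub>R z k) (3 * e n)"
      using tail(2)[of c n] c1 e(1)[of n] by (simp add: dist_norm)
    finally show "(\<Sum>k<N. b k *\<^sub>R a k) + (\<Sum>k. c k *\<^sub>R z k) \<in> W m"
    proof (rule set_mp[OF comb[rule_format], rotated -1])
      show "\<exists>k<n. b k \<noteq> 0 \<or> c k \<noteq> 0"
        using nt by (intro exI[of _ l]) (simp add: n_def)
    qed (use b c in \<open>simp_all add: n_def\<close>)
  qed
  \<comment> \<open>The digits for the \<open>i\<close>-th set start at index \<open>i\<close>, so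
    the perturbation of \<open>a i\<close> has norm at most \<open>2 * e i\<close> and the set stays
    inside \<open>U i\<close>.\<close>
  define d where "d i u k = (if k < i then 0 else cantor_digit (k - i) u)" for i u k
  define h where "h i u = a i + (\<Sum>k. d i u k *\<^sub>R z k)" for i u
  have d01: "d i u k \<in> {0, 1}" and d1: "\<bar>d i u k\<bar> \<le> 1" for i u k
    by (auto simp: d_def cantor_digit_def)
  have sd: "summable (\<lambda>k. d i u k *\<^sub>R z k)" for i u
    using tail(1)[of "d i u" 0] d1 by (auto intro: summable_norm_cancel)
  have diff: "h i u - h j v \<in> (\<Inter>n. W n)"
    if uv: "u \<in> cantor_ternary" "v \<in> cantor_ternary" "i \<noteq> j \<or> u \<noteq> v" for i j u v
  proof -
    define b where "b k = (if k = i then 1 else 0) - (if k = j then 1 else (0::real))" for k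
    define N where "N = Suc (max i j)"
    have "\<exists>l. b l \<noteq> 0 \<or> d i u l - d j v l \<noteq> 0"
    proof (cases "i = j")
      case True
      then obtain k where "cantor_digit k u \<noteq> cantor_digit k v"
        using cantor_digit_separates[OF uv(1,2)] uv(3) by blast
      with True show ?thesis
        by (intro exI[of _ "k + i"]) (auto simp: d_def)
    qed (auto simp: b_def)
    then obtain l where l: "b l \<noteq> 0 \<or> d i u l - d j v l \<noteq> 0"
      by blast
    have "(\<Sum>k<N. b k *\<^sub>R a k) + (\<Sum>k. (d i u k - d j v k) *\<^sub>R z k) \<in> (\<Inter>n. W n)"
    proof (rule limit_in[where b = b and c = "\<lambda>k. d i u k - d j v k" and N = N and l = l])
      show "d i u k - d j v k \<in> {-1,0,1}" for k
        using d01[of i u k] d01[of j v k] by auto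
    qed (use l in \<open>auto simp: b_def N_def\<close>)
    also have "(\<Sum>k<N. b k *\<^sub>R a k) = a i - a j"
      by (simp add: b_def scaleR_left_diff_distrib sum_subtractf if_distrib[of "\<lambda>x. x *\<^sub>R _"] N_def
          cong: if_cong)
    also have "(\<Sum>k. (d i u k - d j v k) *\<^sub>R z k) = (\<Sum>k. d i u k *\<^sub>R z k) - (\<Sum>k. d j v k *\<^sub>R z k)"
      unfolding scaleR_left_diff_distrib by (rule suminf_diff[OF sd sd, symmetric])
    finally show ?thesis
      by (simp add: h_def algebra_simps)
  qed
  have inj: "inj_on (h i) cantor_ternary" for i
  proof (rule inj_onI, rule ccontr)
    fix u v assume "u \<in> cantor_ternary" "v \<in> cantor_ternary" "h i u = h i v" "u \<noteq> v"
    with diff[of u v i i] W(3) show False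
      by simp
  qed
  have cont: "continuous_on cantor_ternary (h i)" for i
  proof -
    have "uniform_limit cantor_ternary (\<lambda>n u. \<Sum>k<n. d i u k *\<^sub>R z k) (\<lambda>u. \<Sum>k. d i u k *\<^sub>R z k) sequentially"
    proof (rule Weierstrass_m_test)
      show "summable (\<lambda>k. norm (z k))"
        using tail(1)[of "\<lambda>_. 1" 0] by simp
      show "norm (d i u k *\<^sub>R z k) \<le> norm (z k)" for u k
        using mult_right_mono[OF d1, of "norm (z k)" i u k] by simp
    qed
    then have "continuous_on cantor_ternary (\<lambda>u. \<Sum>k. d i u k *\<^sub>R z k)"
    proof (rule uniform_limit_theorem[rotated])
      have "continuous_on cantor_ternary (\<lambda>u. d i u k)" for k
        unfolding d_def using continuous_on_cantor_digit by (cases "k < i") (auto simp: eta_contract_eq)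
      then show "\<forall>\<^sub>F n in sequentially. continuous_on cantor_ternary (\<lambda>u. \<Sum>k<n. d i u k *\<^sub>R z k)"
        by (intro always_eventually allI continuous_intros)
    qed auto
    then show ?thesis
      unfolding h_def by (intro continuous_intros)
  qed
  have "h i u \<in> U i" for i u
  proof -
    have "(\<Sum>k. d i u k *\<^sub>R z k) = (\<Sum>k. d i u (k + i) *\<^sub>R z (k + i))"
      by (subst suminf_split_initial_segment[OF sd, of _ _ i]) (simp add: d_def)
    then have "norm (\<Sum>k. d i u k *\<^sub>R z k) \<le> 2 * e i"
      using tail(2)[of "d i u" i] d1 by simp
    then have "h i u \<in> cball (a i) (2 * e i)"
      by (simp add: h_def dist_norm)
    then show ?thesis
      using a by blast
  qed
  moreover have "cantor_set (h i ` cantor_ternary)" for i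
    unfolding cantor_set_def
    using homeomorphic_compact[OF compact_cantor_ternary cont refl inj] homeomorphic_sym by blast
  moreover have "x - y \<in> (\<Inter>n. W n)"
    if xy: "x \<in> (\<Union>j. h j ` cantor_ternary)" "y \<in> (\<Union>j. h j ` cantor_ternary)" "x \<noteq> y" for x y
  proof -
    obtain i u j v where "x = h i u" "y = h j v" "u \<in> cantor_ternary" "v \<in> cantor_ternary"
      using xy(1,2) by blast
    then show ?thesis
      using diff[of u v i j] xy(3) by blast
  qed
  ultimately show ?thesis
    by (intro exI[of _ "\<lambda>j. h j ` cantor_ternary"]) blast
qed

text \<open>\<open>v B\<close> has ternary digit 2 at the positions in \<open>B\<close> and 0
  elsewhere; its recursion \<open>rec\<close> mirrors that of \<open>cantor_stage\<close>. The first
  digit can be read off, since \<open>v B\<close> is at most 1/3 or at least 2/3, so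
  \<open>v\<close> is injective on the sets of naturals.\<close>

lemma uncountable_cantor_ternary: "uncountable cantor_ternary"
proof
  assume C: "countable cantor_ternary"
  define dig :: "nat set \<Rightarrow> nat \<Rightarrow> real" where "dig B k = (if k \<in> B then 2 else 0)" for B k
  define v where "v B = (\<Sum>k. dig B k * (1 / 3) ^ Suc k)" for B
  have le: "norm (dig B k * (1 / 3) ^ Suc k) \<le> 2 / 3 * (1 / 3) ^ k" for B k
    by (simp add: dig_def)
  have s: "summable (\<lambda>k. 2 / 3 * (1 / 3 :: real) ^ k)"
    by (intro summable_mult summable_geometric) simp
  have sv: "summable (\<lambda>k. dig B k * (1 / 3) ^ Suc k)" for B
    by (rule summable_comparison_test[OF _ s]) (use le in auto)
  have v01: "0 \<le> v B" "v B \<le> 1" for B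
  proof -
    show "0 \<le> v B"
      unfolding v_def by (intro suminf_nonneg sv) (simp add: dig_def)
    have "v B \<le> (\<Sum>k. 2 / 3 * (1 / 3) ^ k)"
      unfolding v_def by (intro suminf_le sv s order_trans[OF abs_ge_self le[unfolded real_norm_def]])
    also have "\<dots> = 1"
      by (subst suminf_mult) (auto intro: summable_geometric simp: suminf_geometric)
    finally show "v B \<le> 1" .
  qed
  have rec: "v B = (dig B 0 + v (Suc -` B)) / 3" for B
  proof -
    have "v B = dig B 0 / 3 + (\<Sum>k. dig B (Suc k) * (1 / 3) ^ Suc (Suc k))"
      using suminf_split_head[OF sv, of B] by (simp add: v_def)
    also have "(\<Sum>k. dig B (Suc k) * (1 / 3) ^ Suc (Suc k)) = (\<Sum>k. 1 / 3 * (dig (Suc -` B) k * (1 / 3) ^ Suc k))"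
      by (simp add: dig_def mult_ac)
    also have "\<dots> = 1 / 3 * v (Suc -` B)"
      unfolding v_def by (rule suminf_mult[OF sv])
    finally show ?thesis
      by simp
  qed
  have "v B \<in> cantor_stage n" for B n
  proof (induction n arbitrary: B)
    case (Suc n)
    show ?case
      using Suc[of "Suc -` B"] by (subst rec) (auto simp: dig_def add.commute)
  qed (use v01 in simp)
  then have "range v \<subseteq> cantor_ternary"
    by (auto simp: cantor_ternary_def)
  then have "countable (range v)"
    using C countable_subset by blast
  moreover have "inj v"
  proof (rule injI)
    fix B B' assume "v B = v B'"
    have "(0 \<in> B \<longleftrightarrow> 0 \<in> B') \<and> v (Suc -` B) = v (Suc -` B')" if "v B = v B'" for B B'
      using that v01[of "Suc -` B"] v01[of "Suc -` B'"] rec[of B] rec[of B']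
      by (auto simp: dig_def split: if_splits)
    then have "k \<in> B \<longleftrightarrow> k \<in> B'" if "v B = v B'" for k B B'
      using that
    proof (induction k arbitrary: B B')
      case (Suc k)
      then have "k \<in> Suc -` B \<longleftrightarrow> k \<in> Suc -` B'"
        by blast
      then show ?case
        by simp
    qed blast
    with \<open>v B = v B'\<close> show "B = B'"
      by blast
  qed
  ultimately have "countable (UNIV :: nat set set)"
    using countable_image_inj_eq by blast
  then have "range (from_nat_into (UNIV :: nat set set)) = UNIV"
    by (intro range_from_nat_into) auto
  then show False
    using Cantors_theorem[of "UNIV :: nat set"] by auto
qed

lemma uncountable_cantor_set:
  assumes "cantor_set K"
  shows "uncountable K"
proof -
  obtain f where "f ` K = cantor_ternary"
    using assms unfolding cantor_set_def homeomorphic_def homeomorphism_def by blast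
  then show ?thesis
    using uncountable_cantor_ternary countable_image[of K f] by auto
qed

section \<open>Upper density in a sector\<close>

locale acute_sector =
  fixes \<alpha> :: real
  assumes \<alpha>_pos: "0 < \<alpha>" and \<alpha>_less: "\<alpha> < pi / 2"
begin

lemma tan_\<alpha>_pos: "0 < tan \<alpha>"
  using \<alpha>_pos \<alpha>_less by (rule tan_gt_zero)

text \<open>As \<alpha> is below \<open>pi / 2\<close>, the bound on the argument is a bound on its
  tangent. The linear form makes closedness, additivity and invariance under dilation easy.\<close>

lemma sector_eq: "sector \<alpha> = {z. \<bar>Im z\<bar> \<le> tan \<alpha> * Re z}"
proof (intro set_eqI iffI)
  fix z assume "z \<in> sector \<alpha>"
  then obtain r \<theta> where z: "z = complex_of_real r * cis \<theta>" "0 \<le> r" "\<bar>\<theta>\<bar> \<le> \<alpha>"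
    by (auto simp: sector_def)
  have "cos \<theta> > 0"
    using z(3) \<alpha>_less by (intro cos_gt_zero_pi) auto
  have "\<bar>tan \<theta>\<bar> \<le> tan \<alpha>"
    using tan_mono_le[of \<theta> \<alpha>] tan_mono_le[of "- \<theta>" \<alpha>] z(3) \<alpha>_less by (auto simp: abs_le_iff)
  then have "\<bar>tan \<theta>\<bar> * (r * cos \<theta>) \<le> tan \<alpha> * (r * cos \<theta>)"
    using z(2) \<open>cos \<theta> > 0\<close> by (intro mult_right_mono) auto
  moreover have "\<bar>tan \<theta>\<bar> * (r * cos \<theta>) = \<bar>r * sin \<theta>\<bar>"
    using z(2) \<open>cos \<theta> > 0\<close> by (simp add: tan_def abs_mult)
  ultimately show "z \<in> {z. \<bar>Im z\<bar> \<le> tan \<alpha> * Re z}"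
    by (simp add: z(1))
next
  fix z assume "z \<in> {z. \<bar>Im z\<bar> \<le> tan \<alpha> * Re z}"
  then have z: "\<bar>Im z\<bar> \<le> tan \<alpha> * Re z"
    by simp
  then have "0 \<le> Re z"
    using tan_\<alpha>_pos by (meson abs_ge_zero order_trans zero_le_mult_iff not_less)
  show "z \<in> sector \<alpha>"
  proof (cases "Re z = 0")
    case True
    with z have "z = complex_of_real 0 * cis 0"
      by (simp add: complex_eq_iff)
    then show ?thesis
      using \<alpha>_pos unfolding sector_def by (intro CollectI exI[of _ 0]) auto
  next
    case False
    with \<open>0 \<le> Re z\<close> have Re: "Re z > 0"
      by simp
    define \<theta> where "\<theta> = arctan (Im z / Re z)"
    have "\<bar>Im z / Re z\<bar> \<le> tan \<alpha>"
      using z Re by (simp add: field_simps)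
    then have "arctan (Im z / Re z) \<le> arctan (tan \<alpha>)" "arctan (- (Im z / Re z)) \<le> arctan (tan \<alpha>)"
      unfolding arctan_le_iff by linarith+
    moreover have "arctan (tan \<alpha>) = \<alpha>"
      using \<alpha>_pos \<alpha>_less by (intro arctan_tan) auto
    ultimately have "\<bar>\<theta>\<bar> \<le> \<alpha>"
      by (simp add: \<theta>_def arctan_minus)
    have c: "cos \<theta> > 0"
      unfolding \<theta>_def using arctan_lbound[of "Im z / Re z"] arctan_ubound[of "Im z / Re z"]
      by (intro cos_gt_zero_pi) auto
    have "tan \<theta> = Im z / Re z"
      unfolding \<theta>_def by (rule tan_arctan)
    then have "Im z = Re z / cos \<theta> * sin \<theta>"
      using c Re by (simp add: tan_def field_simps)
    then have "z = complex_of_real (Re z / cos \<theta>) * cis \<theta>"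
      using c by (auto simp: complex_eq_iff)
    moreover have "0 \<le> Re z / cos \<theta>"
      using c Re by simp
    ultimately show ?thesis
      using \<open>\<bar>\<theta>\<bar> \<le> \<alpha>\<close> unfolding sector_def by blast
  qed
qed

lemma sector_add: "s \<in> sector \<alpha> \<Longrightarrow> t \<in> sector \<alpha> \<Longrightarrow> s + t \<in> sector \<alpha>"
  using abs_triangle_ineq[of "Im s" "Im t"] by (simp add: sector_eq distrib_left)

lemma closed_sector: "closed (sector \<alpha>)"
  unfolding sector_eq by (intro closed_Collect_le continuous_intros)

lemma sector_cut_eq: "sector_cut \<alpha> r = sector \<alpha> \<inter> ball 0 r"
  by (auto simp: sector_cut_def)

lemma sector_lebesgue: "sector \<alpha> \<in> sets lebesgue"
  by (rule sets_completionI_sets) (simp add: borel_closed closed_sector)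

lemma sector_cut_lmeasurable: "sector_cut \<alpha> r \<in> lmeasurable"
  unfolding sector_cut_eq using fmeasurable_Int_fmeasurable[OF lmeasurable_ball sector_lebesgue]
  by (simp add: Int_commute)

lemma sector_cut_lmeasurable_Diff: "E \<in> sets lebesgue \<Longrightarrow> sector_cut \<alpha> r - E \<in> lmeasurable"
  by (rule fmeasurable_Diff[OF sector_cut_lmeasurable])

text \<open>Dilation by \<open>r\<close> maps the unit cut onto this one, and the plane has real
  dimension two.\<close>

lemma measure_sector_cut:
  assumes "0 < r"
  shows "measure lebesgue (sector_cut \<alpha> r) = r\<^sup>2 * measure lebesgue (sector_cut \<alpha> 1)"
proof -
  have "sector_cut \<alpha> r = (\<lambda>t. r *\<^sub>R t + 0) ` sector_cut \<alpha> 1"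
  proof (intro set_eqI iffI)
    fix t assume t: "t \<in> sector_cut \<alpha> r"
    then have "t /\<^sub>R r \<in> sector_cut \<alpha> 1"
      using assms by (auto simp: sector_cut_def sector_eq abs_mult field_simps)
    then show "t \<in> (\<lambda>t. r *\<^sub>R t + 0) ` sector_cut \<alpha> 1"
      using assms by (intro image_eqI[of _ _ "t /\<^sub>R r"]) auto
  next
    fix t assume "t \<in> (\<lambda>t. r *\<^sub>R t + 0) ` sector_cut \<alpha> 1"
    then show "t \<in> sector_cut \<alpha> r"
      using assms by (auto simp: sector_cut_def sector_eq abs_mult mult.left_commute)
  qed
  then show ?thesis
    using assms by (simp only: measure_lebesgue_affine) simp
qed

lemma measure_sector_cut_1_pos: "0 < measure lebesgue (sector_cut \<alpha> 1)"
proof -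
  let ?S = "{z. \<bar>Im z\<bar> < tan \<alpha> * Re z} \<inter> ball 0 1"
  have o: "open ?S"
    by (intro open_Int open_Collect_less continuous_intros) auto
  have "1 / 2 \<in> ?S"
    using tan_\<alpha>_pos by simp
  then have "\<not> negligible ?S"
    using o by (intro open_not_negligible) blast+
  moreover have "?S \<subseteq> sector_cut \<alpha> 1"
    by (auto simp: sector_cut_eq sector_eq)
  ultimately have "\<not> negligible (sector_cut \<alpha> 1)"
    using negligible_subset by blast
  then show ?thesis
    using sector_cut_lmeasurable[of 1]
    by (metis negligible_iff_measure0 measure_nonneg less_eq_real_def)
qed

lemma measure_sector_cut_pos: "0 < r \<Longrightarrow> 0 < measure lebesgue (sector_cut \<alpha> r)"
  using measure_sector_cut[of r] measure_sector_cut_1_pos by simp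

text \<open>The quotient never exceeds 1, so the limit superior is 1 unless it is bounded away from
  1 eventually. Complements are used because their measures are subadditive, so error terms can
  simply be added.\<close>

lemma upper_density_eq_1_iff:
  assumes E: "E \<in> sets lebesgue"
  shows "upper_density \<alpha> E = 1 \<longleftrightarrow>
    (\<forall>\<eta>>0. \<forall>m. \<exists>r>m. measure lebesgue (sector_cut \<alpha> r - E) \<le> \<eta> * measure lebesgue (sector_cut \<alpha> r))"
proof -
  define f where "f r = measure lebesgue (E \<inter> sector_cut \<alpha> r) / measure lebesgue (sector_cut \<alpha> r)" for r
  have f: "1 - \<eta> \<le> f r \<longleftrightarrow>
      measure lebesgue (sector_cut \<alpha> r - E) \<le> \<eta> * measure lebesgue (sector_cut \<alpha> r)"
    if "0 < r" for r \<eta>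
  proof -
    have "measure lebesgue (sector_cut \<alpha> r - E) =
        measure lebesgue (sector_cut \<alpha> r) - measure lebesgue (E \<inter> sector_cut \<alpha> r)"
      using measurable_measure_Diff[of "sector_cut \<alpha> r" lebesgue "E \<inter> sector_cut \<alpha> r"] E
        sector_cut_lmeasurable[of r]
      by (simp add: Diff_Int fmeasurableD sets.Int)
    then have "measure lebesgue (E \<inter> sector_cut \<alpha> r) =
        measure lebesgue (sector_cut \<alpha> r) - measure lebesgue (sector_cut \<alpha> r - E)"
      by simp
    then show ?thesis
      using measure_sector_cut_pos[OF that] by (auto simp: f_def le_divide_eq left_diff_distrib)
  qed
  have le: "f r \<le> 1" for r
  proof -
    have "measure lebesgue (E \<inter> sector_cut \<alpha> r) \<le> measure lebesgue (sector_cut \<alpha> r)"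
      by (intro measure_mono_fmeasurable sets.Int E fmeasurableD sector_cut_lmeasurable) auto
    then show ?thesis
      unfolding f_def by (simp add: divide_le_eq_1 less_le)
  qed
  have "Limsup at_top (\<lambda>r. ereal (f r)) \<le> 1"
    using le by (intro Limsup_bounded always_eventually) auto
  then have "upper_density \<alpha> E = 1 \<longleftrightarrow> \<not> Limsup at_top (\<lambda>r. ereal (f r)) < 1"
    unfolding upper_density_def f_def by auto
  also have "\<dots> \<longleftrightarrow> (\<forall>\<eta>>0. \<forall>m. \<exists>r>m. 0 < r \<and> 1 - \<eta> \<le> f r)"
  proof (intro iffI allI impI)
    fix \<eta> m :: real
    assume L: "\<not> Limsup at_top (\<lambda>r. ereal (f r)) < 1" and "0 < \<eta>"
    show "\<exists>r>m. 0 < r \<and> 1 - \<eta> \<le> f r"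
    proof (rule ccontr)
      assume none: "\<not> (\<exists>r>m. 0 < r \<and> 1 - \<eta> \<le> f r)"
      have "ereal (f r) \<le> ereal (1 - \<eta>)" if "r \<ge> max m 0 + 1" for r
      proof -
        have "m < r" "0 < r"
          using that by linarith+
        with none have "\<not> 1 - \<eta> \<le> f r"
          by blast
        then show ?thesis
          by simp
      qed
      then have "Limsup at_top (\<lambda>r. ereal (f r)) \<le> ereal (1 - \<eta>)"
        by (intro Limsup_bounded eventually_at_top_linorderI)
      also have "\<dots> < 1"
        using \<open>0 < \<eta>\<close> by simp
      finally show False
        using L by simp
    qed
  next
    assume R: "\<forall>\<eta>>0. \<forall>m. \<exists>r>m. 0 < r \<and> 1 - \<eta> \<le> f r"
    show "\<not> Limsup at_top (\<lambda>r. ereal (f r)) < 1"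
    proof
      assume "Limsup at_top (\<lambda>r. ereal (f r)) < 1"
      then obtain c where c: "Limsup at_top (\<lambda>r. ereal (f r)) < ereal c" "ereal c < 1"
        using ereal_dense2 by blast
      obtain m where m: "\<forall>r\<ge>m. f r < c"
        using Limsup_lessD[OF c(1)] by (auto simp: eventually_at_top_linorder)
      obtain r where r: "r > m" "1 - (1 - c) \<le> f r"
        using R[rule_format, of "1 - c" m] c(2) by auto
      show False
        using m[rule_format, of r] r by simp
    qed
  qed
  also have "\<dots> \<longleftrightarrow> (\<forall>\<eta>>0. \<forall>m. \<exists>r>m. measure lebesgue (sector_cut \<alpha> r - E) \<le> \<eta> * measure lebesgue (sector_cut \<alpha> r))"
    (is "?L \<longleftrightarrow> ?R")
  proof
    assume ?L
    then show ?R
      using f by blast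
  next
    assume R: ?R
    show ?L
    proof (intro allI impI)
      fix \<eta> m :: real
      assume "0 < \<eta>"
      then obtain r where "r > max m 0" "measure lebesgue (sector_cut \<alpha> r - E) \<le> \<eta> * measure lebesgue (sector_cut \<alpha> r)"
        using R by blast
      then show "\<exists>r>m. 0 < r \<and> 1 - \<eta> \<le> f r"
        using f[of r \<eta>] by auto
    qed
  qed
  finally show ?thesis .
qed

lemma upper_density_1D:
  assumes "E \<in> sets lebesgue" "upper_density \<alpha> E = 1" "0 < \<eta>"
  shows "\<exists>r>m. measure lebesgue (sector_cut \<alpha> r - E) \<le> \<eta> * measure lebesgue (sector_cut \<alpha> r)"
  using upper_density_eq_1_iff[THEN iffD1, OF assms(1,2)] assms(3) by simp

lemma measure_sector_cut_Diff_le: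
  assumes "A \<in> sets lebesgue" "E \<in> sets lebesgue"
    and "sector_cut \<alpha> r - E \<subseteq> (sector_cut \<alpha> r - A) \<union> sector_cut \<alpha> s"
  shows "measure lebesgue (sector_cut \<alpha> r - E) \<le>
    measure lebesgue (sector_cut \<alpha> r - A) + measure lebesgue (sector_cut \<alpha> s)"
proof -
  note cuts = sector_cut_lmeasurable_Diff[OF assms(1)] sector_cut_lmeasurable
  have "measure lebesgue (sector_cut \<alpha> r - E) \<le> measure lebesgue ((sector_cut \<alpha> r - A) \<union> sector_cut \<alpha> s)"
    by (rule measure_mono_fmeasurable[OF assms(3) fmeasurableD[OF sector_cut_lmeasurable_Diff[OF assms(2)]]
      fmeasurable.Un[OF cuts]])
  also have "\<dots> \<le> measure lebesgue (sector_cut \<alpha> r - A) + measure lebesgue (sector_cut \<alpha> s)"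
    by (intro measure_Un_le cuts[THEN fmeasurableD])
  finally show ?thesis .
qed

text \<open>A set confined to radius \<open>R\<close> fills at most the cut of radius
  \<open>r / 2\<close>, a quarter of the cut of radius \<open>r\<close>, so its complement cannot be
  as small as one half.\<close>

lemma upper_density_1_nonempty:
  assumes "E \<in> sets lebesgue" "upper_density \<alpha> E = 1"
  obtains t where "t \<in> E" "t \<in> sector \<alpha>" "cmod t \<ge> R"
proof -
  have "\<exists>t\<in>E \<inter> sector \<alpha>. R \<le> cmod t"
  proof (rule ccontr)
    assume "\<not> ?thesis"
    then have far: "cmod t < R" if "t \<in> E" "t \<in> sector \<alpha>" for t
      using that by force
    obtain r where r: "r > max 1 (2 * R)" "measure lebesgue (sector_cut \<alpha> r - E) \<le> 1 / 2 * measure lebesgue (sector_cut \<alpha> r)"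
      using upper_density_1D[OF assms, of "1 / 2" "max 1 (2 * R)"] by auto
    have "measure lebesgue (sector_cut \<alpha> r) \<le>
        measure lebesgue (sector_cut \<alpha> r - E) + measure lebesgue (sector_cut \<alpha> (r / 2))"
      using measure_sector_cut_Diff_le[OF assms(1) sets.empty_sets, of r "r / 2"] far r(1)
      by (force simp: sector_cut_def)
    also have "\<dots> \<le> 1 / 2 * measure lebesgue (sector_cut \<alpha> r) + measure lebesgue (sector_cut \<alpha> (r / 2))"
      using r(2) by simp
    finally show False
      using r(1) measure_sector_cut[of r] measure_sector_cut[of "r / 2"] measure_sector_cut_pos[of r]
      by (simp add: power_divide)
  qed
  then show thesis
    using that by blast
qed

text \<open>A bounded part of the sector has a vanishing share of large cuts, so only the tail of
  \<open>A\<close> matters.\<close>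

lemma upper_density_1_mono_tail:
  assumes A: "A \<in> sets lebesgue" "upper_density \<alpha> A = 1" and E: "E \<in> sets lebesgue"
    and sub: "\<And>t. t \<in> A \<Longrightarrow> t \<in> sector \<alpha> \<Longrightarrow> R \<le> cmod t \<Longrightarrow> t \<in> E"
  shows "upper_density \<alpha> E = 1"
  unfolding upper_density_eq_1_iff[OF E]
proof (intro allI impI)
  fix \<eta> m :: real
  assume \<eta>: "0 < \<eta>"
  define \<kappa> where "\<kappa> = measure lebesgue (sector_cut \<alpha> 1)"
  define R' where "R' = max R 1"
  \<comment> \<open>Half of \<eta> pays for the complement of \<open>A\<close>, half for the bounded
    cut: as \<open>r\<close> exceeds both 1 and the last bound, \<open>R'\<^sup>2\<close> is at most
    \<eta> / 2 times \<open>r\<^sup>2\<close>.\<close>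
  obtain r where r: "r > max m (max 1 (2 * R'\<^sup>2 / \<eta>))"
    "measure lebesgue (sector_cut \<alpha> r - A) \<le> \<eta> / 2 * measure lebesgue (sector_cut \<alpha> r)"
    using upper_density_1D[OF A, of "\<eta> / 2" "max m (max 1 (2 * R'\<^sup>2 / \<eta>))"] \<eta> by auto
  have "measure lebesgue (sector_cut \<alpha> r - E) \<le>
      measure lebesgue (sector_cut \<alpha> r - A) + measure lebesgue (sector_cut \<alpha> R')"
    using sub by (intro measure_sector_cut_Diff_le A E) (force simp: sector_cut_def R'_def)
  also have "measure lebesgue (sector_cut \<alpha> R') \<le> \<eta> / 2 * measure lebesgue (sector_cut \<alpha> r)"
  proof -
    have "2 * R'\<^sup>2 / \<eta> \<le> r * 1"
      using r(1) by simp
    also have "\<dots> \<le> r\<^sup>2"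
      unfolding power2_eq_square using r(1) by (intro mult_left_mono) auto
    finally have "R'\<^sup>2 \<le> \<eta> / 2 * r\<^sup>2"
      using \<eta> by (simp add: field_simps)
    then have "R'\<^sup>2 * \<kappa> \<le> \<eta> / 2 * r\<^sup>2 * \<kappa>"
      by (intro mult_right_mono) (auto simp: \<kappa>_def)
    moreover have "0 < r" "0 < R'"
      using r(1) by (auto simp: R'_def)
    ultimately show ?thesis
      using measure_sector_cut[of R'] measure_sector_cut[of r] by (simp add: \<kappa>_def)
  qed
  finally have "measure lebesgue (sector_cut \<alpha> r - E) \<le> \<eta> * measure lebesgue (sector_cut \<alpha> r)"
    using r(2) by simp
  then show "\<exists>r>m. measure lebesgue (sector_cut \<alpha> r - E) \<le> \<eta> * measure lebesgue (sector_cut \<alpha> r)"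
    using r(1) by auto
qed

text \<open>Translation by \<open>s\<close> preserves measure, keeps the sector inside itself, and
  sends points outside \<open>E\<close> to points outside \<open>A\<close>, while the radius grows
  only by \<open>cmod s\<close>.\<close>

lemma upper_density_1_shift:
  assumes A: "A \<in> sets lebesgue" "upper_density \<alpha> A = 1" and E: "E \<in> sets lebesgue"
    and s: "s \<in> sector \<alpha>" and sub: "\<And>t. t \<in> sector \<alpha> \<Longrightarrow> s + t \<in> A \<Longrightarrow> t \<in> E"
  shows "upper_density \<alpha> E = 1"
  unfolding upper_density_eq_1_iff[OF E]
proof (intro allI impI)
  fix \<eta> m :: real
  assume \<eta>: "0 < \<eta>"
  define \<kappa> where "\<kappa> = measure lebesgue (sector_cut \<alpha> 1)"
  \<comment> \<open>The bound \<open>2 * cmod s + 1\<close> ensures that \<open>R\<close> is at most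
    twice \<open>r\<close>; the area then grows by at most 4, which \<eta> / 4 compensates.\<close>
  obtain R where R: "R > max (m + cmod s) (2 * cmod s + 1)"
    "measure lebesgue (sector_cut \<alpha> R - A) \<le> \<eta> / 4 * measure lebesgue (sector_cut \<alpha> R)"
    using upper_density_1D[OF A, of "\<eta> / 4" "max (m + cmod s) (2 * cmod s + 1)"] \<eta> by auto
  define r where "r = R - cmod s"
  have r: "r > m" "R \<le> 2 * r" "0 < r" "0 < R"
    using R(1) by (auto simp: r_def) (smt (verit) norm_ge_zero)+
  have "measure lebesgue (sector_cut \<alpha> r - E) = measure lebesgue ((+) s ` (sector_cut \<alpha> r - E))"
    by (simp add: measure_translation)
  also have "\<dots> \<le> measure lebesgue (sector_cut \<alpha> R - A)"
  proof (intro measure_mono_fmeasurable fmeasurableD[OF measurable_translation] sector_cut_lmeasurable_Diff A(1) E)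
    show "(+) s ` (sector_cut \<alpha> r - E) \<subseteq> sector_cut \<alpha> R - A"
    proof safe
      fix t assume t: "t \<in> sector_cut \<alpha> r" "t \<notin> E"
      show "s + t \<in> sector_cut \<alpha> R"
        using t(1) s norm_triangle_ineq[of s t] by (auto simp: sector_cut_def r_def intro: sector_add)
      show False if "s + t \<in> A"
        using sub that t by (auto simp: sector_cut_def)
    qed
  qed
  also have "\<dots> \<le> \<eta> / 4 * measure lebesgue (sector_cut \<alpha> R)"
    by (rule R(2))
  also have "\<dots> \<le> \<eta> / 4 * (4 * measure lebesgue (sector_cut \<alpha> r))"
  proof -
    have "R\<^sup>2 \<le> (2 * r)\<^sup>2"
      using r by (intro power_mono) auto
    then have "R\<^sup>2 * \<kappa> \<le> (2 * r)\<^sup>2 * \<kappa>"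
      by (intro mult_right_mono) (auto simp: \<kappa>_def)
    then have "measure lebesgue (sector_cut \<alpha> R) \<le> 4 * measure lebesgue (sector_cut \<alpha> r)"
      using measure_sector_cut[OF r(3)] measure_sector_cut[OF r(4)] by (simp add: \<kappa>_def power_mult_distrib)
    then show ?thesis
      using \<eta> by (intro mult_left_mono) auto
  qed
  finally show "\<exists>r>m. measure lebesgue (sector_cut \<alpha> r - E) \<le> \<eta> * measure lebesgue (sector_cut \<alpha> r)"
    using r(1) by auto
qed

text \<open>Radii \<open>R\<close> are chosen so that \<open>E n\<close> nearly fills the cut of
  radius \<open>R (Suc n)\<close>. \<open>B\<close> enforces membership in \<open>E k\<close> only
  from radius \<open>R k\<close> on; inside the cut of radius \<open>R (Suc k)\<close> just the
  constraints up to \<open>k\<close> are active, and \<open>E k\<close> implies them all.\<close>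

lemma upper_density_1_diagonal:
  assumes E: "\<And>n. E n \<in> sets lebesgue" "\<And>n. upper_density \<alpha> (E n) = 1" and dec: "decseq E"
  obtains B where "B \<in> sets lebesgue" "B \<subseteq> sector \<alpha>" "upper_density \<alpha> B = 1"
    "\<And>n. \<exists>R. \<forall>t\<in>B. R \<le> cmod t \<longrightarrow> t \<in> E n"
proof -
  have "\<exists>R. \<forall>n. real n \<le> R n \<and> (R n < R (Suc n) \<and>
    measure lebesgue (sector_cut \<alpha> (R (Suc n)) - E n) \<le> 1 / real (Suc n) * measure lebesgue (sector_cut \<alpha> (R (Suc n))))"
  proof (rule dependent_nat_choice)
    fix r :: real and n
    obtain r' where "r' > max r (real (Suc n))"
      "measure lebesgue (sector_cut \<alpha> r' - E n) \<le> 1 / real (Suc n) * measure lebesgue (sector_cut \<alpha> r')"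
      using upper_density_1D[OF E, of "1 / real (Suc n)" "max r (real (Suc n))"] by auto
    then show "\<exists>r'. real (Suc n) \<le> r' \<and> (r < r' \<and>
      measure lebesgue (sector_cut \<alpha> r' - E n) \<le> 1 / real (Suc n) * measure lebesgue (sector_cut \<alpha> r'))"
      by (intro exI[of _ r']) auto
  qed auto
  then obtain R where R: "\<And>n. real n \<le> R n" "\<And>n. R n < R (Suc n)"
    "\<And>n. measure lebesgue (sector_cut \<alpha> (R (Suc n)) - E n) \<le> 1 / real (Suc n) * measure lebesgue (sector_cut \<alpha> (R (Suc n)))"
    by blast
  have mono: "strict_mono R"
    using R(2) by (simp add: strict_mono_Suc_iff)
  define B where "B = sector \<alpha> \<inter> (\<Inter>k. E k \<union> ball 0 (R k))"
  have B: "B \<in> sets lebesgue"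
    unfolding B_def using E(1) sector_lebesgue by (intro sets.Int sets.countable_INT sets.Un) auto
  have "upper_density \<alpha> B = 1"
    unfolding upper_density_eq_1_iff[OF B]
  proof (intro allI impI)
    fix \<eta> m :: real
    assume "0 < \<eta>"
    obtain k :: nat where k: "max m (1 / \<eta>) < real k"
      using reals_Archimedean2 by blast
    have "sector_cut \<alpha> (R (Suc k)) - B \<subseteq> sector_cut \<alpha> (R (Suc k)) - E k"
    proof safe
      fix t assume t: "t \<in> sector_cut \<alpha> (R (Suc k))" "t \<in> E k" "t \<notin> B"
      then obtain j where j: "t \<notin> E j" "R j \<le> cmod t"
        by (auto simp: B_def sector_cut_def)
      then have "R j < R (Suc k)"
        using t(1) by (auto simp: sector_cut_def)
      then have "j \<le> k"
        using mono by (simp add: strict_mono_less)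
      then show False
        using decseqD[OF dec] t(2) j(1) by blast
    qed
    then have "measure lebesgue (sector_cut \<alpha> (R (Suc k)) - B) \<le> measure lebesgue (sector_cut \<alpha> (R (Suc k)) - E k)"
      by (intro measure_mono_fmeasurable fmeasurableD sector_cut_lmeasurable_Diff B E)
    also have "\<dots> \<le> 1 / real (Suc k) * measure lebesgue (sector_cut \<alpha> (R (Suc k)))"
      by (rule R(3))
    also have "\<dots> \<le> \<eta> * measure lebesgue (sector_cut \<alpha> (R (Suc k)))"
    proof (intro mult_right_mono measure_nonneg)
      have "1 < \<eta> * real k"
        using k \<open>0 < \<eta>\<close> by (simp add: field_simps)
      also have "\<dots> \<le> \<eta> * real (Suc k)"
        using \<open>0 < \<eta>\<close> by simp
      finally show "1 / real (Suc k) \<le> \<eta>"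
        by (simp add: field_simps)
    qed
    finally show "\<exists>r>m. measure lebesgue (sector_cut \<alpha> r - B) \<le> \<eta> * measure lebesgue (sector_cut \<alpha> r)"
      using k R(1)[of "Suc k"] by (intro exI[of _ "R (Suc k)"]) auto
  qed
  moreover have "\<exists>R. \<forall>t\<in>B. R \<le> cmod t \<longrightarrow> t \<in> E n" for n
    by (rule exI[of _ "R n"]) (auto simp: B_def)
  ultimately show thesis
    using that B by (auto simp: B_def)
qed

end

section \<open>Distributional behaviour of orbits\<close>

lemma eventually_at_infinity_within_iff:
  "eventually P (inf at_infinity (principal A)) \<longleftrightarrow> (\<exists>R. \<forall>t\<in>A. R \<le> norm t \<longrightarrow> P t)"
  unfolding eventually_inf_principal eventually_at_infinity by blast

locale C0_sector = acute_sector +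
  fixes T :: "complex \<Rightarrow> 'a \<Rightarrow> 'a::banach"
  assumes C0: "C0_semigroup \<alpha> T"
begin

lemma linear_T: "t \<in> sector \<alpha> \<Longrightarrow> bounded_linear (T t)"
  using C0 by (simp add: C0_semigroup_def)

lemmas T_simps = linear_T[THEN bounded_linear.linear, THEN linear_add]
  linear_T[THEN bounded_linear.linear, THEN linear_diff]
  linear_T[THEN bounded_linear.linear, THEN linear_scale]
  linear_T[THEN bounded_linear.linear, THEN linear_0]

lemma T_add: "s \<in> sector \<alpha> \<Longrightarrow> t \<in> sector \<alpha> \<Longrightarrow> T (s + t) x = T t (T s x)"
  using C0 unfolding C0_semigroup_def by (metis add.commute comp_apply)

lemma continuous_orbit: "continuous_on (sector \<alpha>) (\<lambda>t. T t x)"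
  using C0 by (simp add: C0_semigroup_def continuous_on_def)

definition above :: "real \<Rightarrow> 'a \<Rightarrow> complex set" where
  "above c x = {t \<in> sector \<alpha>. norm (T t x) > c}"

definition below :: "real \<Rightarrow> 'a \<Rightarrow> complex set" where
  "below c x = {t \<in> sector \<alpha>. norm (T t x) < c}"

text \<open>Orbits are continuous on the sector only, so closed preimages are taken relative to the
  sector, itself closed, and complemented within it.\<close>

lemma above_lebesgue: "above c x \<in> sets lebesgue" and below_lebesgue: "below c x \<in> sets lebesgue"
proof -
  have c: "continuous_on (sector \<alpha>) (\<lambda>t. norm (T t x))"
    by (intro continuous_intros continuous_orbit)
  have *: "sector \<alpha> - (sector \<alpha> \<inter> (\<lambda>t. norm (T t x)) -` C) \<in> sets lebesgue" if "closed C" for C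
  proof -
    have "closed (sector \<alpha> \<inter> (\<lambda>t. norm (T t x)) -` C)"
      by (rule continuous_closed_preimage[OF c closed_sector that])
    then show ?thesis
      by (intro sets.Diff sector_lebesgue sets_completionI_sets) (simp add: borel_closed)
  qed
  have "above c x = sector \<alpha> - (sector \<alpha> \<inter> (\<lambda>t. norm (T t x)) -` {..c})"
    "below c x = sector \<alpha> - (sector \<alpha> \<inter> (\<lambda>t. norm (T t x)) -` {c..})"
    by (auto simp: above_def below_def)
  then show "above c x \<in> sets lebesgue" "below c x \<in> sets lebesgue"
    using *[of "{..c}"] *[of "{c..}"] by simp_all
qed

text \<open>Uniform boundedness principle: orbits are continuous, hence bounded on the compact piece
  \<open>?K\<close>, and Baire gives some \<open>C n\<close> with interior.\<close>

lemma locally_bounded: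
  obtains M where "M > 0" "\<And>t x. t \<in> sector_cut \<alpha> r \<Longrightarrow> norm (T t x) \<le> M * norm x"
proof -
  let ?K = "sector \<alpha> \<inter> cball 0 r"
  define C where "C n = {x. \<forall>t\<in>?K. norm (T t x) \<le> real n}" for n
  have cl: "closed (C n)" for n
  proof -
    have "C n = (\<Inter>t\<in>?K. {x. norm (T t x) \<le> real n})"
      by (auto simp: C_def)
    moreover have "closed {x. norm (T t x) \<le> real n}" if "t \<in> ?K" for t
      using that by (intro closed_Collect_le continuous_intros bounded_linear.continuous_on[OF linear_T]) auto
    ultimately show ?thesis
      by auto
  qed
  have "\<exists>n. interior (C n) \<noteq> {}"
  proof (rule ccontr)
    assume "\<not> ?thesis"
    then have "closure (- C n) = UNIV" for n
      by (simp add: closure_complement)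
    then have "closure (\<Inter>n. - C n) = UNIV"
      using cl by (intro closure_INT_open_dense) auto
    moreover have "x \<notin> (\<Inter>n. - C n)" for x
    proof -
      have "compact ?K"
        using closed_sector by (metis Int_commute compact_Int_closed compact_cball)
      then have "compact ((\<lambda>t. T t x) ` ?K)"
        by (intro compact_continuous_image continuous_on_subset[OF continuous_orbit]) auto
      then obtain b where b: "\<forall>t\<in>?K. norm (T t x) \<le> b"
        using compact_imp_bounded[of "(\<lambda>t. T t x) ` ?K"] unfolding bounded_iff by blast
      obtain n where "b \<le> real n"
        using real_arch_simple by blast
      with b have "x \<in> C n"
        unfolding C_def by (auto intro: order_trans)
      then show ?thesis
        by blast
    qed
    then have "(\<Inter>n. - C n) = {}"
      by blast
    ultimately show False
      by simp
  qed
  then obtain n x0 where "x0 \<in> interior (C n)"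
    by blast
  then obtain e where e: "e > 0" "ball x0 e \<subseteq> C n"
    by (auto simp: mem_interior)
  have x0: "x0 \<in> C n"
    using e by auto
  \<comment> \<open>For \<open>l = e / (2 * norm x)\<close> the vector
    \<open>x0 + l *\<^sub>R x\<close> stays in the ball; subtracting \<open>T t x0\<close> bounds
    \<open>l * norm (T t x)\<close> by \<open>2 * real n\<close>, whence the factor
    \<open>4 / e\<close>. The added 1 keeps \<open>M\<close> positive.\<close>
  define M where "M = 4 * (real n + 1) / e"
  have "norm (T t x) \<le> M * norm x" if t: "t \<in> sector_cut \<alpha> r" for t x
  proof (cases "x = 0")
    case True
    then show ?thesis
      using t by (simp add: sector_cut_def T_simps)
  next
    case False
    define l where "l = e / (2 * norm x)"
    have l: "l > 0" "l * norm x = e / 2"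
      using False e(1) by (auto simp: l_def)
    have ts: "t \<in> sector \<alpha>" and tK: "t \<in> ?K"
      using t by (auto simp: sector_cut_def)
    have "x0 + l *\<^sub>R x \<in> ball x0 e"
      using l e(1) by (simp add: dist_norm)
    then have "norm (T t (x0 + l *\<^sub>R x)) \<le> real n" "norm (T t x0) \<le> real n"
      using e(2) x0 tK unfolding C_def by blast+
    then have "norm (T t x0 + l *\<^sub>R T t x) \<le> real n" "norm (T t x0) \<le> real n"
      using ts by (simp_all add: T_simps)
    then have "norm (l *\<^sub>R T t x) \<le> 2 * real n"
      using norm_triangle_ineq4[of "T t x0 + l *\<^sub>R T t x" "T t x0"] by simp
    then have "norm (T t x) \<le> 2 * (real n + 1) / l"
      using l(1) by (simp add: field_simps)
    also have "\<dots> = M * norm x"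
      using False e(1) by (simp add: M_def l_def field_simps)
    finally show ?thesis .
  qed
  moreover have "M > 0"
    using e(1) by (simp add: M_def)
  ultimately show thesis
    using that by blast
qed

text \<open>Level sets replace the existential set \<open>A\<close>: such conditions can be tested
  on single cuts, which is what the category argument needs.\<close>

definition dist_null :: "'a \<Rightarrow> bool" where
  "dist_null x \<longleftrightarrow> (\<forall>\<epsilon>>0. upper_density \<alpha> (below \<epsilon> x) = 1)"

definition dist_unbounded :: "'a \<Rightarrow> bool" where
  "dist_unbounded x \<longleftrightarrow> (\<forall>c. upper_density \<alpha> (above c x) = 1)"

text \<open>The diagonal lemma merges the level sets for \<open>1 / real (Suc n)\<close> into one
  \<open>A\<close>; conversely each level set contains a tail of \<open>A\<close>.\<close>

lemma dist_null_iff: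
  "dist_null x \<longleftrightarrow> (\<exists>A. A \<in> sets lebesgue \<and> A \<subseteq> sector \<alpha> \<and> upper_density \<alpha> A = 1 \<and>
    ((\<lambda>t. norm (T t x)) \<longlongrightarrow> 0) (inf at_infinity (principal A)))" (is "_ \<longleftrightarrow> ?R")
proof
  assume x: "dist_null x"
  have "decseq (\<lambda>n. below (1 / real (Suc n)) x)"
  proof (rule decseq_SucI)
    fix n
    have "1 / real (Suc (Suc n)) \<le> 1 / real (Suc n)"
      by (intro divide_left_mono) auto
    then show "below (1 / real (Suc (Suc n))) x \<subseteq> below (1 / real (Suc n)) x"
      unfolding below_def by fastforce
  qed
  moreover have "upper_density \<alpha> (below (1 / real (Suc n)) x) = 1" for n
    using x by (simp add: dist_null_def)
  ultimately obtain A where A: "A \<in> sets lebesgue" "A \<subseteq> sector \<alpha>" "upper_density \<alpha> A = 1"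
    "\<And>n. \<exists>R. \<forall>t\<in>A. R \<le> cmod t \<longrightarrow> t \<in> below (1 / real (Suc n)) x"
    using upper_density_1_diagonal[of "\<lambda>n. below (1 / real (Suc n)) x"] below_lebesgue by metis
  have "((\<lambda>t. norm (T t x)) \<longlongrightarrow> 0) (inf at_infinity (principal A))"
  proof (rule tendstoI)
    fix e :: real assume "e > 0"
    then obtain n where n: "1 / real (Suc n) < e"
      using nat_approx_posE by blast
    obtain R where "\<forall>t\<in>A. R \<le> cmod t \<longrightarrow> t \<in> below (1 / real (Suc n)) x"
      using A(4) by blast
    with n show "\<forall>\<^sub>F t in inf at_infinity (principal A). dist (norm (T t x)) 0 < e"
      unfolding eventually_at_infinity_within_iff by (intro exI[of _ R]) (force simp: below_def)
  qed
  with A show ?R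
    by blast
next
  assume ?R
  then obtain A where A: "A \<in> sets lebesgue" "A \<subseteq> sector \<alpha>" "upper_density \<alpha> A = 1"
    "((\<lambda>t. norm (T t x)) \<longlongrightarrow> 0) (inf at_infinity (principal A))"
    by blast
  show "dist_null x"
    unfolding dist_null_def
  proof (intro allI impI)
    fix \<epsilon> :: real assume "\<epsilon> > 0"
    from tendstoD[OF A(4) this] obtain R where "\<forall>t\<in>A. R \<le> norm t \<longrightarrow> norm (T t x) < \<epsilon>"
      unfolding eventually_at_infinity_within_iff by auto
    then show "upper_density \<alpha> (below \<epsilon> x) = 1"
      using upper_density_1_mono_tail[OF A(1,3) below_lebesgue, of R \<epsilon> x] by (simp add: below_def)
  qed
qed

lemma dist_unbounded_iff:
  "dist_unbounded x \<longleftrightarrow> (\<exists>B. B \<in> sets lebesgue \<and> B \<subseteq> sector \<alpha> \<and> upper_density \<alpha> B = 1 \<and>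
    filterlim (\<lambda>t. norm (T t x)) at_top (inf at_infinity (principal B)))" (is "_ \<longleftrightarrow> ?R")
proof
  assume x: "dist_unbounded x"
  have "decseq (\<lambda>n. above (real n) x)"
    by (rule decseq_SucI) (auto simp: above_def)
  moreover have "upper_density \<alpha> (above (real n) x) = 1" for n
    using x by (simp add: dist_unbounded_def)
  ultimately obtain B where B: "B \<in> sets lebesgue" "B \<subseteq> sector \<alpha>" "upper_density \<alpha> B = 1"
    "\<And>n. \<exists>R. \<forall>t\<in>B. R \<le> cmod t \<longrightarrow> t \<in> above (real n) x"
    using upper_density_1_diagonal[of "\<lambda>n. above (real n) x"] above_lebesgue by metis
  have "filterlim (\<lambda>t. norm (T t x)) at_top (inf at_infinity (principal B))"
    unfolding filterlim_at_top
  proof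
    fix c :: real
    obtain n where n: "c \<le> real n"
      using real_arch_simple by blast
    obtain R where "\<forall>t\<in>B. R \<le> cmod t \<longrightarrow> t \<in> above (real n) x"
      using B(4) by blast
    with n show "\<forall>\<^sub>F t in inf at_infinity (principal B). c \<le> norm (T t x)"
      unfolding eventually_at_infinity_within_iff by (intro exI[of _ R]) (force simp: above_def)
  qed
  with B show ?R
    by blast
next
  assume ?R
  then obtain B where B: "B \<in> sets lebesgue" "B \<subseteq> sector \<alpha>" "upper_density \<alpha> B = 1"
    "filterlim (\<lambda>t. norm (T t x)) at_top (inf at_infinity (principal B))"
    by blast
  show "dist_unbounded x"
    unfolding dist_unbounded_def
  proof
    fix c
    \<comment> \<open>Level \<open>c + 1\<close> turns the weak inequality of
      \<open>filterlim_at_top\<close> into the strict one in \<open>above\<close>.\<close>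
    obtain R where "\<forall>t\<in>B. R \<le> norm t \<longrightarrow> c + 1 \<le> norm (T t x)"
      using B(4) unfolding filterlim_at_top eventually_at_infinity_within_iff by blast
    then show "upper_density \<alpha> (above c x) = 1"
      using upper_density_1_mono_tail[OF B(1,3) above_lebesgue, of R c x] by (force simp: above_def)
  qed
qed

text \<open>A positive lower limit is a uniform positive bound on a tail; conversely
  \<open>above \<delta> x\<close> itself serves as \<open>B\<close>.\<close>

lemma upper_density_above_iff:
  "(\<exists>\<delta>>0. upper_density \<alpha> (above \<delta> x) = 1) \<longleftrightarrow>
    (\<exists>B. B \<in> sets lebesgue \<and> B \<subseteq> sector \<alpha> \<and> upper_density \<alpha> B = 1 \<and>
      Liminf (inf at_infinity (principal B)) (\<lambda>t. ereal (norm (T t x))) > 0)" (is "?L \<longleftrightarrow> ?R")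
proof
  assume ?L
  then obtain \<delta> where \<delta>: "\<delta> > 0" "upper_density \<alpha> (above \<delta> x) = 1"
    by blast
  have "ereal \<delta> \<le> Liminf (inf at_infinity (principal (above \<delta> x))) (\<lambda>t. ereal (norm (T t x)))"
    by (intro Liminf_bounded) (auto simp: eventually_inf_principal above_def)
  with \<delta>(1) have "0 < Liminf (inf at_infinity (principal (above \<delta> x))) (\<lambda>t. ereal (norm (T t x)))"
    by (meson ereal_less(2) less_le_trans)
  moreover have "above \<delta> x \<subseteq> sector \<alpha>"
    by (auto simp: above_def)
  ultimately show ?R
    using \<delta>(2) above_lebesgue by blast
next
  assume ?R
  then obtain B where B: "B \<in> sets lebesgue" "B \<subseteq> sector \<alpha>" "upper_density \<alpha> B = 1"
    "Liminf (inf at_infinity (principal B)) (\<lambda>t. ereal (norm (T t x))) > 0"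
    by blast
  obtain \<delta> where \<delta>: "0 < ereal \<delta>" "ereal \<delta> < Liminf (inf at_infinity (principal B)) (\<lambda>t. ereal (norm (T t x)))"
    using ereal_dense2[OF B(4)] by blast
  obtain R where "\<forall>t\<in>B. R \<le> norm t \<longrightarrow> \<delta> < norm (T t x)"
    using less_LiminfD[OF \<delta>(2)] unfolding eventually_at_infinity_within_iff by auto
  then have "upper_density \<alpha> (above \<delta> x) = 1"
    using upper_density_1_mono_tail[OF B(1,3) above_lebesgue, of R \<delta> x] by (simp add: above_def)
  with \<delta>(1) show ?L
    by auto
qed

section \<open>The notions of the theorem in terms of level sets\<close>

lemma dist_semi_irregular_iff:
  "dist_semi_irregular \<alpha> T x \<longleftrightarrow> dist_null x \<and> (\<exists>\<delta>>0. upper_density \<alpha> (above \<delta> x) = 1)"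
  unfolding dist_semi_irregular_def dist_null_iff upper_density_above_iff by blast

lemma dist_irregular_iff: "dist_irregular \<alpha> T x \<longleftrightarrow> dist_null x \<and> dist_unbounded x"
  unfolding dist_irregular_def dist_null_iff dist_unbounded_iff by blast

lemma dist_irregular_imp_semi: "dist_irregular \<alpha> T x \<Longrightarrow> dist_semi_irregular \<alpha> T x"
  unfolding dist_irregular_iff dist_semi_irregular_iff dist_unbounded_def using zero_less_one by blast

lemma below_diff: "{t \<in> sector \<alpha>. norm (T t x - T t y) < \<epsilon>} = below \<epsilon> (x - y)"
  and above_diff: "{t \<in> sector \<alpha>. norm (T t x - T t y) > \<epsilon>} = above \<epsilon> (x - y)"
  by (auto simp: below_def above_def T_simps)

lemma DProx_iff: "(x, y) \<in> DProx \<alpha> T \<longleftrightarrow> dist_null (x - y)"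
  by (simp add: DProx_def below_diff dist_null_def)

lemma dist_chaotic_pair_iff: "dist_chaotic_pair \<alpha> T x y \<longleftrightarrow> dist_semi_irregular \<alpha> T (x - y)"
  unfolding dist_chaotic_pair_def below_diff above_diff dist_semi_irregular_iff dist_null_def by blast

text \<open>Supplies the hypothesis of \<open>mycielski_differences\<close> that 0 lies outside the
  intersection.\<close>

lemma not_dist_unbounded_0: "\<not> dist_unbounded 0"
proof
  assume "dist_unbounded 0"
  then have "upper_density \<alpha> (above 0 0) = 1"
    by (simp add: dist_unbounded_def)
  from upper_density_1_nonempty[OF above_lebesgue this] obtain t where "t \<in> above 0 0"
    by blast
  then show False
    by (auto simp: above_def T_simps)
qed

section \<open>Genericity of distributional irregularity\<close>

text \<open>The one index \<open>n\<close> is the level, the lower bound for the radius and the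
  precision, so countably many conditions capture \<open>dist_unbounded\<close>;
  \<open>returns\<close> does the same for \<open>dist_null\<close>.\<close>

definition escapes :: "nat \<Rightarrow> 'a set" where
  "escapes n = {x. \<exists>r>real n. measure lebesgue (sector_cut \<alpha> r - above (real n) x) \<le>
    1 / real (Suc n) * measure lebesgue (sector_cut \<alpha> r)}"

definition returns :: "nat \<Rightarrow> 'a set" where
  "returns n = {x. \<exists>r>real n. measure lebesgue (sector_cut \<alpha> r - below (1 / real (Suc n)) x) \<le>
    1 / real (Suc n) * measure lebesgue (sector_cut \<alpha> r)}"

lemma dist_unboundedI:
  assumes "\<And>n. x \<in> escapes n"
  shows "dist_unbounded x"
  unfolding dist_unbounded_def upper_density_eq_1_iff[OF above_lebesgue]
proof (intro allI impI)
  fix c \<eta> m :: real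
  assume "\<eta> > 0"
  obtain n where n: "max (max c m) (1 / \<eta>) \<le> real n"
    using real_arch_simple by blast
  obtain r where r: "r > real n" "measure lebesgue (sector_cut \<alpha> r - above (real n) x) \<le>
    1 / real (Suc n) * measure lebesgue (sector_cut \<alpha> r)"
    using assms[of n] unfolding escapes_def by blast
  have "measure lebesgue (sector_cut \<alpha> r - above c x) \<le> measure lebesgue (sector_cut \<alpha> r - above (real n) x)"
    using n by (intro measure_mono_fmeasurable fmeasurableD sector_cut_lmeasurable_Diff above_lebesgue)
      (auto simp: above_def)
  also note r(2)
  also have "1 / real (Suc n) * measure lebesgue (sector_cut \<alpha> r) \<le> \<eta> * measure lebesgue (sector_cut \<alpha> r)"
    using n \<open>\<eta> > 0\<close> by (intro mult_right_mono) (auto simp: field_simps)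
  finally show "\<exists>r>m. measure lebesgue (sector_cut \<alpha> r - above c x) \<le> \<eta> * measure lebesgue (sector_cut \<alpha> r)"
    using r(1) n by (intro exI[of _ r]) auto
qed

lemma dist_nullI:
  assumes "\<And>n. x \<in> returns n"
  shows "dist_null x"
  unfolding dist_null_def upper_density_eq_1_iff[OF below_lebesgue]
proof (intro allI impI)
  fix \<epsilon> \<eta> m :: real
  assume "\<epsilon> > 0" "\<eta> > 0"
  obtain n where n: "max (max (1 / \<epsilon>) m) (1 / \<eta>) \<le> real n"
    using real_arch_simple by blast
  obtain r where r: "r > real n" "measure lebesgue (sector_cut \<alpha> r - below (1 / real (Suc n)) x) \<le>
    1 / real (Suc n) * measure lebesgue (sector_cut \<alpha> r)"
    using assms[of n] unfolding returns_def by blast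
  have "1 / real (Suc n) \<le> \<epsilon>"
    using n \<open>\<epsilon> > 0\<close> by (auto simp: field_simps)
  then have "measure lebesgue (sector_cut \<alpha> r - below \<epsilon> x) \<le>
      measure lebesgue (sector_cut \<alpha> r - below (1 / real (Suc n)) x)"
    by (intro measure_mono_fmeasurable fmeasurableD sector_cut_lmeasurable_Diff below_lebesgue)
      (auto simp: below_def)
  also note r(2)
  also have "1 / real (Suc n) * measure lebesgue (sector_cut \<alpha> r) \<le> \<eta> * measure lebesgue (sector_cut \<alpha> r)"
    using n \<open>\<eta> > 0\<close> by (intro mult_right_mono) (auto simp: field_simps)
  finally show "\<exists>r>m. measure lebesgue (sector_cut \<alpha> r - below \<epsilon> x) \<le> \<eta> * measure lebesgue (sector_cut \<alpha> r)"
    using r(1) n by (intro exI[of _ r]) auto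
qed

text \<open>Follows from local boundedness; it carries an estimate on one fixed cut over to a whole
  ball of vectors.\<close>

lemma T_uniformly_close:
  assumes "\<epsilon> > 0"
  obtains d where "d > 0"
    "\<And>x y t. y \<in> ball x d \<Longrightarrow> t \<in> sector_cut \<alpha> r \<Longrightarrow> \<bar>norm (T t y) - norm (T t x)\<bar> < \<epsilon>"
proof -
  obtain M where M: "M > 0" "\<And>t x. t \<in> sector_cut \<alpha> r \<Longrightarrow> norm (T t x) \<le> M * norm x"
    using locally_bounded by blast
  have "\<bar>norm (T t y) - norm (T t x)\<bar> < \<epsilon>" if "y \<in> ball x (\<epsilon> / M)" "t \<in> sector_cut \<alpha> r" for x y t
  proof -
    have "\<bar>norm (T t y) - norm (T t x)\<bar> \<le> norm (T t (y - x))"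
      using that norm_triangle_ineq3[of "T t y" "T t x"] by (simp add: T_simps sector_cut_def)
    also have "\<dots> \<le> M * norm (y - x)"
      using M(2) that by blast
    also have "\<dots> < \<epsilon>"
      using that(1) M(1) by (simp add: dist_norm norm_minus_commute field_simps)
    finally show ?thesis .
  qed
  moreover have "\<epsilon> / M > 0"
    using assms M by simp
  ultimately show thesis
    using that by blast
qed

text \<open>The extra unit of height absorbs the perturbation of the orbit on the cut.\<close>

lemma interior_escapesI:
  assumes "r > real n" and "measure lebesgue (sector_cut \<alpha> r - above (real n + 1) x) \<le>
    1 / real (Suc n) * measure lebesgue (sector_cut \<alpha> r)"
  shows "x \<in> interior (escapes n)"
proof -
  obtain d where d: "d > 0" "\<And>x y t. y \<in> ball x d \<Longrightarrow> t \<in> sector_cut \<alpha> r \<Longrightarrow> \<bar>norm (T t y) - norm (T t x)\<bar> < 1"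
    using T_uniformly_close[of 1 r] by auto
  have "ball x d \<subseteq> escapes n"
  proof
    fix y assume y: "y \<in> ball x d"
    have "measure lebesgue (sector_cut \<alpha> r - above (real n) y) \<le> measure lebesgue (sector_cut \<alpha> r - above (real n + 1) x)"
      using d(2)[OF y]
      by (intro measure_mono_fmeasurable fmeasurableD sector_cut_lmeasurable_Diff above_lebesgue)
        (force simp: above_def)
    then show "y \<in> escapes n"
      unfolding escapes_def using assms by (intro CollectI exI[of _ r]) linarith
  qed
  with d(1) show ?thesis
    by (meson mem_interior)
qed

text \<open>The cut is chosen for half of the required level; the other half absorbs the
  perturbation.\<close>

lemma interior_returnsI:
  assumes "dist_null x"
  shows "x \<in> interior (returns n)"
proof -
  define \<epsilon> where "\<epsilon> = 1 / (2 * real (Suc n))"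
  have \<epsilon>: "\<epsilon> > 0" "2 * \<epsilon> = 1 / real (Suc n)"
    by (auto simp: \<epsilon>_def field_simps)
  have "upper_density \<alpha> (below \<epsilon> x) = 1"
    using assms \<epsilon>(1) by (simp add: dist_null_def)
  from upper_density_1D[OF below_lebesgue this, of "1 / real (Suc n)" "real n"]
  obtain r where r: "r > real n" "measure lebesgue (sector_cut \<alpha> r - below \<epsilon> x) \<le>
    1 / real (Suc n) * measure lebesgue (sector_cut \<alpha> r)"
    by auto
  obtain d where d: "d > 0" "\<And>x y t. y \<in> ball x d \<Longrightarrow> t \<in> sector_cut \<alpha> r \<Longrightarrow> \<bar>norm (T t y) - norm (T t x)\<bar> < \<epsilon>"
    using T_uniformly_close[OF \<epsilon>(1), of r] by auto
  have "ball x d \<subseteq> returns n"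
  proof
    fix y assume y: "y \<in> ball x d"
    have "measure lebesgue (sector_cut \<alpha> r - below (2 * \<epsilon>) y) \<le> measure lebesgue (sector_cut \<alpha> r - below \<epsilon> x)"
      using d(2)[OF y]
      by (intro measure_mono_fmeasurable fmeasurableD sector_cut_lmeasurable_Diff below_lebesgue)
        (force simp: below_def)
    then show "y \<in> returns n"
      unfolding returns_def \<epsilon>(2)[symmetric] using r \<epsilon>(2) by (intro CollectI exI[of _ r]) simp
  qed
  with d(1) show ?thesis
    by (meson mem_interior)
qed

text \<open>
  Pigeonhole: wherever \<open>norm (T t z) > 2 * c\<close>, at most one of the vectors \<open>x + j *\<^sub>R z\<close>
  has an orbit of norm at most \<open>c\<close>.
\<close>

lemma exists_multiple_escaping:
  assumes "0 < N" and z: "measure lebesgue (sector_cut \<alpha> r - above (2 * c) z) \<le> \<eta> * measure lebesgue (sector_cut \<alpha> r)"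
  shows "\<exists>j<N. measure lebesgue (sector_cut \<alpha> r - above c (x + real j *\<^sub>R z)) \<le>
    (1 / real N + \<eta>) * measure lebesgue (sector_cut \<alpha> r)"
proof -
  let ?m = "measure lebesgue (sector_cut \<alpha> r)"
  \<comment> \<open>Times at which the \<open>j\<close>-th vector is low although \<open>z\<close>
    is large. As disjoint parts of the cut, \<open>N\<close> of them have average measure at most
    \<open>1 / real N\<close> of it; the remaining times are charged to \<eta>.\<close>
  define D where "D j = (sector_cut \<alpha> r - above c (x + real j *\<^sub>R z)) \<inter> above (2 * c) z" for j :: nat
  have Dm: "D j \<in> lmeasurable" for j
    unfolding D_def by (intro fmeasurable_Int_fmeasurable sector_cut_lmeasurable_Diff above_lebesgue)
  have disj: "disjnt (D i) (D j)" if "i \<noteq> j" for i j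
  proof -
    have False if t: "t \<in> D i" "t \<in> D j" for t
    proof -
      have ts: "t \<in> sector \<alpha>" and big: "norm (T t z) > 2 * c"
        and small: "norm (T t (x + real i *\<^sub>R z)) \<le> c" "norm (T t (x + real j *\<^sub>R z)) \<le> c"
        using t by (auto simp: D_def above_def sector_cut_def)
      have "1 * norm (T t z) \<le> \<bar>real i - real j\<bar> * norm (T t z)"
        using \<open>i \<noteq> j\<close> by (intro mult_right_mono) auto
      also have "\<dots> = norm (T t (x + real i *\<^sub>R z) - T t (x + real j *\<^sub>R z))"
        using ts by (simp add: T_simps norm_scaleR[symmetric] scaleR_left_diff_distrib del: norm_scaleR)
      also have "\<dots> \<le> 2 * c"
        using norm_triangle_ineq4[of "T t (x + real i *\<^sub>R z)" "T t (x + real j *\<^sub>R z)"] small by linarith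
      finally show False
        using big by simp
    qed
    then show ?thesis
      by (auto simp: disjnt_def)
  qed
  have "(\<Sum>j<N. measure lebesgue (D j)) = measure lebesgue (\<Union>j<N. D j)"
    using Dm disj by (intro measure_UNION'[symmetric]) (auto simp: pairwise_def)
  also have "\<dots> \<le> ?m"
    by (intro measure_mono_fmeasurable sector_cut_lmeasurable sets.finite_UN fmeasurableD Dm) (auto simp: D_def)
  finally have sum: "(\<Sum>j<N. measure lebesgue (D j)) \<le> ?m" .
  have "\<exists>j<N. measure lebesgue (D j) \<le> 1 / real N * ?m"
  proof (rule ccontr)
    assume "\<not> ?thesis"
    then have "(\<Sum>j<N. 1 / real N * ?m) < (\<Sum>j<N. measure lebesgue (D j))"
      using \<open>0 < N\<close> by (intro sum_strict_mono) (auto simp: not_le)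
    with sum \<open>0 < N\<close> show False
      by simp
  qed
  then obtain j where j: "j < N" "measure lebesgue (D j) \<le> 1 / real N * ?m"
    by blast
  have "measure lebesgue (sector_cut \<alpha> r - above c (x + real j *\<^sub>R z)) \<le>
      measure lebesgue (D j \<union> (sector_cut \<alpha> r - above (2 * c) z))"
    by (intro measure_mono_fmeasurable fmeasurable.Un fmeasurableD[OF sector_cut_lmeasurable_Diff]
        sector_cut_lmeasurable_Diff above_lebesgue Dm) (auto simp: D_def)
  also have "\<dots> \<le> measure lebesgue (D j) + measure lebesgue (sector_cut \<alpha> r - above (2 * c) z)"
    by (intro measure_Un_le fmeasurableD sector_cut_lmeasurable_Diff above_lebesgue Dm)
  also have "\<dots> \<le> (1 / real N + \<eta>) * ?m"
    using j(2) z by (simp add: distrib_right)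
  finally show ?thesis
    using j(1) by blast
qed

lemma dense_interior_escapes:
  assumes "\<delta> > 0" and small: "\<And>\<epsilon>. \<epsilon> > 0 \<Longrightarrow> \<exists>y. norm y < \<epsilon> \<and> upper_density \<alpha> (above \<delta> y) = 1"
  shows "closure (interior (escapes n)) = UNIV"
proof -
  have "\<exists>y\<in>interior (escapes n). dist y x < \<epsilon>" if "\<epsilon> > 0" for x \<epsilon>
  proof -
    \<comment> \<open>\<open>c\<close> has the spare unit for \<open>interior_escapesI\<close>, and
      \<open>l\<close> raises the level \<delta> to \<open>2 * c\<close>. The pigeonhole and
      \<open>z\<close> itself each lose \<open>1 / real N\<close>, together
      \<open>1 / real (Suc n)\<close>. The bound on \<open>norm y\<close> keeps all \<open>N\<close>
      candidates within \<epsilon> of \<open>x\<close>.\<close>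
    define c where "c = real n + 1"
    define N where "N = 2 * Suc n"
    define l where "l = 2 * c / \<delta>"
    have pos: "l > 0" "real N > 0"
      using \<open>\<delta> > 0\<close> by (auto simp: l_def c_def N_def)
    then have "\<epsilon> / (l * real N) > 0"
      using that by simp
    from small[OF this] obtain y where y: "norm y < \<epsilon> / (l * real N)" "upper_density \<alpha> (above \<delta> y) = 1"
      by blast
    define z where "z = l *\<^sub>R y"
    have "above \<delta> y \<subseteq> above (2 * c) z"
      using pos \<open>\<delta> > 0\<close> by (auto simp: above_def z_def T_simps l_def field_simps)
    then have "upper_density \<alpha> (above (2 * c) z) = 1"
      by (intro upper_density_1_mono_tail[OF above_lebesgue y(2) above_lebesgue]) auto
    from upper_density_1D[OF above_lebesgue this, of "1 / real N" "real n"] pos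
    obtain r where r: "r > real n" "measure lebesgue (sector_cut \<alpha> r - above (2 * c) z) \<le>
      1 / real N * measure lebesgue (sector_cut \<alpha> r)"
      by auto
    obtain j where j: "j < N" "measure lebesgue (sector_cut \<alpha> r - above c (x + real j *\<^sub>R z)) \<le>
      (1 / real N + 1 / real N) * measure lebesgue (sector_cut \<alpha> r)"
      using exists_multiple_escaping[OF _ r(2), of N x] pos by auto
    have "1 / real N + 1 / real N = 1 / real (Suc n)"
      by (simp add: N_def field_simps)
    with j(2) have "x + real j *\<^sub>R z \<in> interior (escapes n)"
      using r(1) by (intro interior_escapesI[of n r]) (simp_all add: c_def)
    moreover have "dist (x + real j *\<^sub>R z) x < \<epsilon>"
    proof -
      have "dist (x + real j *\<^sub>R z) x = real j * (l * norm y)"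
        using pos by (simp add: dist_norm z_def)
      also have "\<dots> \<le> real N * (l * norm y)"
        using j(1) pos by (intro mult_right_mono) auto
      also have "\<dots> < \<epsilon>"
        using y(1) pos by (simp add: field_simps)
      finally show ?thesis .
    qed
    ultimately show ?thesis
      by blast
  qed
  then show ?thesis
    by (auto simp: closure_approachable)
qed

text \<open>Hub of all equivalences. The open sets are kept explicit, instead of using
  \<open>residual\<close>, because the Cantor set construction works with them.\<close>

definition generically_irregular :: bool where
  "generically_irregular \<longleftrightarrow> (\<exists>W :: nat \<Rightarrow> 'a set. (\<forall>n. open (W n) \<and> closure (W n) = UNIV) \<and>
    (\<forall>x\<in>\<Inter>n. W n. dist_irregular \<alpha> T x))"

lemma closure_mono_UNIV: "closure S = UNIV \<Longrightarrow> S \<subseteq> S' \<Longrightarrow> closure S' = UNIV"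
  using closure_mono[of S S'] by auto

lemma generically_irregularI:
  assumes null: "closure {x. dist_null x} = UNIV"
    and "\<delta> > 0" and small: "\<And>\<epsilon>. \<epsilon> > 0 \<Longrightarrow> \<exists>y. norm y < \<epsilon> \<and> upper_density \<alpha> (above \<delta> y) = 1"
  shows generically_irregular
  unfolding generically_irregular_def
proof (intro exI conjI allI ballI)
  \<comment> \<open>Parity interleaves the two countable families into one sequence.\<close>
  define W where "W n = (if even n then interior (escapes (n div 2)) else interior (returns (n div 2)))" for n
  fix n
  show "open (W n)"
    by (simp add: W_def)
  have "closure (interior (returns n)) = UNIV" for n
    by (rule closure_mono_UNIV[OF null]) (auto intro: interior_returnsI)
  then show "closure (W n) = UNIV"
    using dense_interior_escapes[OF assms(2) small] by (simp add: W_def)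
next
  fix x assume x: "x \<in> (\<Inter>n. if even n then interior (escapes (n div 2)) else interior (returns (n div 2)))"
  have "x \<in> escapes n" "x \<in> returns n" for n
    using INT_D[OF x UNIV_I, of "2 * n"] INT_D[OF x UNIV_I, of "2 * n + 1"] interior_subset by auto
  then show "dist_irregular \<alpha> T x"
    unfolding dist_irregular_iff by (blast intro: dist_nullI dist_unboundedI)
qed

section \<open>The implications between the assertions\<close>

lemma generic_imp_residual:
  assumes generically_irregular
  shows "\<exists>S. residual S \<and> (\<forall>x\<in>S. dist_irregular \<alpha> T x)"
proof -
  obtain W :: "nat \<Rightarrow> 'a set" where W: "\<And>n. open (W n)" "\<And>n. closure (W n) = UNIV"
    "\<forall>x\<in>\<Inter>n. W n. dist_irregular \<alpha> T x"
    using assms unfolding generically_irregular_def by blast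
  have "gdelta (\<Inter>n. W n)"
    using W(1) by (intro gdelta.intros) auto
  moreover have "closure (\<Inter>n. W n) = UNIV"
    using W by (intro closure_INT_open_dense) auto
  ultimately show ?thesis
    using W(3) unfolding residual_def by blast
qed

lemma residual_imp_dense_semi:
  assumes "\<exists>S. residual S \<and> (\<forall>x\<in>S. dist_irregular \<alpha> T x)"
  shows "closure {x. dist_semi_irregular \<alpha> T x} = UNIV"
proof -
  obtain S G where "G \<subseteq> S" "closure G = UNIV" "\<forall>x\<in>S. dist_irregular \<alpha> T x"
    using assms unfolding residual_def by blast
  then show ?thesis
    using closure_mono_UNIV[of G "{x. dist_semi_irregular \<alpha> T x}"] dist_irregular_imp_semi by blast
qed

text \<open>
  If \<open>x\<close> is semi-irregular, then the points \<open>T s x\<close> of its orbit come arbitrarily close to \<open>0\<close>,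
  whereas their orbits are shifts of the orbit of \<open>x\<close> and thus exceed the same \<open>\<delta>\<close> with density one.
\<close>

lemma dense_semi_imp_generic:
  assumes dense: "closure {x. dist_semi_irregular \<alpha> T x} = UNIV"
  shows generically_irregular
proof -
  have "{x. dist_semi_irregular \<alpha> T x} \<noteq> {}"
    using dense by (metis UNIV_not_empty closure_empty)
  then obtain x \<delta> where x: "dist_null x" "\<delta> > 0" "upper_density \<alpha> (above \<delta> x) = 1"
    unfolding dist_semi_irregular_iff by blast
  show ?thesis
  proof (rule generically_irregularI[OF _ x(2)])
    show "closure {x. dist_null x} = UNIV"
      by (rule closure_mono_UNIV[OF dense]) (auto simp: dist_semi_irregular_iff)
    fix \<epsilon> :: real assume "\<epsilon> > 0"
    then have "upper_density \<alpha> (below \<epsilon> x) = 1"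
      using x(1) by (simp add: dist_null_def)
    from upper_density_1_nonempty[OF below_lebesgue this]
    obtain s where s: "s \<in> sector \<alpha>" "norm (T s x) < \<epsilon>"
      by (auto simp: below_def)
    have "upper_density \<alpha> (above \<delta> (T s x)) = 1"
      by (rule upper_density_1_shift[OF above_lebesgue x(3) above_lebesgue s(1)])
        (use s in \<open>auto simp: above_def T_add\<close>)
    with s show "\<exists>y. norm y < \<epsilon> \<and> upper_density \<alpha> (above \<delta> y) = 1"
      by blast
  qed
qed

text \<open>A proximal pair near \<open>(u, 0)\<close> has a null difference near \<open>u\<close>,
  and sensitivity at 0 provides the small vectors.\<close>

lemma prox_sensitive_imp_generic:
  assumes "closure (DProx \<alpha> T) = UNIV" "dist_sensitive \<alpha> T"
  shows generically_irregular
proof -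
  obtain \<delta> where \<delta>: "\<delta> > 0" "\<And>x \<epsilon>. \<epsilon> > 0 \<Longrightarrow> \<exists>y. norm (x - y) < \<epsilon> \<and> upper_density \<alpha> (above \<delta> (x - y)) = 1"
    using assms(2) unfolding dist_sensitive_def above_diff by blast
  show ?thesis
  proof (rule generically_irregularI[OF _ \<delta>(1)])
    have "\<exists>y\<in>{x. dist_null x}. dist y u < \<epsilon>" if pos: "\<epsilon> > 0" for u :: 'a and \<epsilon>
    proof -
      have "(u, 0) \<in> closure (DProx \<alpha> T)"
        using assms(1) by simp
      then obtain p where p: "p \<in> DProx \<alpha> T" "dist p (u, 0) < \<epsilon> / 2"
        using half_gt_zero[OF pos] unfolding closure_approachable by blast
      obtain x y where [simp]: "p = (x, y)"
        by (cases p)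
      have "dist x u < \<epsilon> / 2" "dist y 0 < \<epsilon> / 2"
        using p(2) dist_fst_le[of p "(u, 0)"] dist_snd_le[of p "(u, 0)"] by auto
      then have "dist (x - y) u < \<epsilon>"
        using norm_triangle_ineq4[of "x - u" y] by (simp add: dist_norm algebra_simps)
      then show ?thesis
        using p(1) by (auto simp: DProx_iff)
    qed
    then show "closure {x. dist_null x} = UNIV"
      by (auto simp: closure_approachable)
    fix \<epsilon> :: real assume "\<epsilon> > 0"
    then show "\<exists>y. norm y < \<epsilon> \<and> upper_density \<alpha> (above \<delta> y) = 1"
      using \<delta>(2)[of \<epsilon> 0] by blast
  qed
qed

text \<open>With an irregular \<open>z\<close> near \<open>x - y\<close>, the pair
  \<open>(y + z, y)\<close> is proximal and near \<open>(x, y)\<close>. Orbits of irregular vectors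
  exceed every level, so 1 serves as sensitivity constant.\<close>

lemma generic_imp_prox_sensitive:
  assumes generically_irregular
  shows "closure (DProx \<alpha> T) = UNIV \<and> dist_sensitive \<alpha> T"
proof -
  obtain S G where "G \<subseteq> S" "closure G = UNIV" "\<forall>x\<in>S. dist_irregular \<alpha> T x"
    using generic_imp_residual[OF assms] unfolding residual_def by blast
  then have "closure {x. dist_irregular \<alpha> T x} = UNIV"
    using closure_mono_UNIV[of G "{x. dist_irregular \<alpha> T x}"] by blast
  then have near: "\<exists>z. dist_irregular \<alpha> T z \<and> norm (z - u) < \<epsilon>" if "\<epsilon> > 0" for u \<epsilon>
    using that closure_approachable[of u "{x. dist_irregular \<alpha> T x}"] by (auto simp: dist_norm)
  have "\<exists>p\<in>DProx \<alpha> T. dist p q < \<epsilon>" if pos: "\<epsilon> > 0" for q :: "'a \<times> 'a" and \<epsilon>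
  proof -
    obtain x y where [simp]: "q = (x, y)"
      by (cases q)
    obtain z where z: "dist_irregular \<alpha> T z" "norm (z - (x - y)) < \<epsilon>"
      using near[OF pos] by blast
    have "(y + z, y) \<in> DProx \<alpha> T"
      using z(1) by (simp add: DProx_iff dist_irregular_iff)
    moreover have "dist (y + z, y) q < \<epsilon>"
      using z(2) by (simp add: dist_Pair_Pair dist_norm algebra_simps)
    ultimately show ?thesis
      by blast
  qed
  then have "closure (DProx \<alpha> T) = UNIV"
    by (auto simp: closure_approachable)
  moreover have "dist_sensitive \<alpha> T"
    unfolding dist_sensitive_def above_diff
  proof (intro exI[of _ 1] conjI allI impI)
    fix x :: 'a and \<epsilon> :: real assume "\<epsilon> > 0"
    then obtain z where z: "dist_irregular \<alpha> T z" "norm (z - 0) < \<epsilon>"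
      using near by blast
    then show "\<exists>y. norm (x - y) < \<epsilon> \<and> upper_density \<alpha> (above 1 (x - y)) = 1"
      by (intro exI[of _ "x - z"]) (auto simp: dist_irregular_iff dist_unbounded_def)
  qed simp
  ultimately show ?thesis
    by blast
qed

lemma generic_imp_cantor_scrambled:
  fixes U :: "nat \<Rightarrow> 'a set"
  assumes generically_irregular and U: "\<And>j. open (U j)" "\<And>j. U j \<noteq> {}"
  shows "\<exists>K. (\<forall>j. cantor_set (K j) \<and> K j \<subseteq> U j) \<and> dist_scrambled \<alpha> T (\<Union>j. K j)"
proof -
  obtain W :: "nat \<Rightarrow> 'a set" where W: "\<And>n. open (W n)" "\<And>n. closure (W n) = UNIV"
    "\<forall>x\<in>\<Inter>n. W n. dist_irregular \<alpha> T x"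
    using assms(1) unfolding generically_irregular_def by blast
  have "0 \<notin> (\<Inter>n. W n)"
    using W(3) not_dist_unbounded_0 unfolding dist_irregular_iff by blast
  from mycielski_differences[where W = W and U = U, OF W(1,2) this U]
  obtain K where K: "\<forall>j. cantor_set (K j) \<and> K j \<subseteq> U j"
    "\<forall>x\<in>\<Union>j. K j. \<forall>y\<in>\<Union>j. K j. x \<noteq> y \<longrightarrow> x - y \<in> (\<Inter>n. W n)"
    by (elim exE conjE)
  have "uncountable (\<Union>j. K j)"
    using uncountable_cantor_set[of "K 0"] K(1) countable_subset[of "K 0" "\<Union>j. K j"] by blast
  moreover have "dist_chaotic_pair \<alpha> T x y" if "x \<in> (\<Union>j. K j)" "y \<in> (\<Union>j. K j)" "x \<noteq> y" for x y
  proof -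
    have "x - y \<in> (\<Inter>n. W n)"
      using K(2) that by blast
    with W(3) have "dist_irregular \<alpha> T (x - y)"
      by (rule bspec)
    then show ?thesis
      unfolding dist_chaotic_pair_iff by (rule dist_irregular_imp_semi)
  qed
  ultimately show ?thesis
    using K(1) unfolding dist_scrambled_def by blast
qed

lemma dense_semiI:
  assumes "\<And>u \<epsilon>. \<epsilon> > 0 \<Longrightarrow> \<exists>x y. x \<noteq> y \<and> x \<in> ball u \<epsilon> \<and> y \<in> ball 0 \<epsilon> \<and> dist_chaotic_pair \<alpha> T x y"
  shows "closure {x. dist_semi_irregular \<alpha> T x} = UNIV"
proof -
  have "\<exists>v\<in>{x. dist_semi_irregular \<alpha> T x}. dist v u < \<epsilon>" if "\<epsilon> > 0" for u \<epsilon>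
  proof -
    obtain x y where xy: "x \<in> ball u (\<epsilon> / 2)" "y \<in> ball 0 (\<epsilon> / 2)" "dist_chaotic_pair \<alpha> T x y"
      using assms[of "\<epsilon> / 2" u] \<open>\<epsilon> > 0\<close> by auto
    then have "dist (x - y) u < \<epsilon>"
      using norm_triangle_ineq4[of "x - u" y] by (simp add: dist_norm algebra_simps norm_minus_commute)
    with xy(3) show ?thesis
      by (auto simp: dist_chaotic_pair_iff)
  qed
  then show ?thesis
    by (auto simp: closure_approachable)
qed

lemma cantor_scrambled_imp_dense_semi:
  assumes "\<And>U :: nat \<Rightarrow> 'a set. (\<forall>j. open (U j) \<and> U j \<noteq> {}) \<Longrightarrow>
    \<exists>K. (\<forall>j. cantor_set (K j) \<and> K j \<subseteq> U j) \<and> dist_scrambled \<alpha> T (\<Union>j. K j)"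
  shows "closure {x. dist_semi_irregular \<alpha> T x} = UNIV"
proof (rule dense_semiI)
  fix u :: 'a and \<epsilon> :: real
  assume "\<epsilon> > 0"
  \<comment> \<open>Only \<open>K 0\<close> and \<open>K 1\<close> are used, one near
    \<open>u\<close> and one near 0.\<close>
  define U where "U j = (if j = 0 then ball u \<epsilon> else ball 0 \<epsilon>)" for j :: nat
  have "\<forall>j. open (U j) \<and> U j \<noteq> {}"
    using \<open>\<epsilon> > 0\<close> by (auto simp: U_def)
  from assms[OF this] obtain K where K: "\<forall>j. cantor_set (K j) \<and> K j \<subseteq> U j" "dist_scrambled \<alpha> T (\<Union>j. K j)"
    by blast
  have unc: "uncountable (K j)" for j
    using K(1) uncountable_cantor_set by blast
  then obtain y where y: "y \<in> K 1"
    by (metis countable_empty equals0I)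
  \<comment> \<open>The two Cantor sets may overlap, so uncountability is used to pick a point
    different from \<open>y\<close>.\<close>
  have "K 0 - {y} \<noteq> {}"
    using unc[of 0] by (metis countable_empty countable_insert Diff_eq_empty_iff subset_singletonD)
  then obtain x where x: "x \<in> K 0" "x \<noteq> y"
    by blast
  have "dist_chaotic_pair \<alpha> T x y"
    using K(2) x y unfolding dist_scrambled_def by blast
  moreover have "x \<in> ball u \<epsilon>" "y \<in> ball 0 \<epsilon>"
    using K(1)[rule_format, of 0] K(1)[rule_format, of 1] x(1) y by (auto simp: U_def)
  ultimately show "\<exists>x y. x \<noteq> y \<and> x \<in> ball u \<epsilon> \<and> y \<in> ball 0 \<epsilon> \<and> dist_chaotic_pair \<alpha> T x y"
    using x(2) by blast
qed

lemma densely_chaotic_imp_dense_semi: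
  assumes "densely_dist_chaotic \<alpha> T"
  shows "closure {x. dist_semi_irregular \<alpha> T x} = UNIV"
proof (rule dense_semiI)
  fix u :: 'a and \<epsilon> :: real
  assume "\<epsilon> > 0"
  obtain K where K: "closure K = UNIV" "uncountable K"
    "\<And>x y. x \<in> K \<Longrightarrow> y \<in> K \<Longrightarrow> x \<noteq> y \<Longrightarrow> dist_chaotic_pair \<alpha> T x y"
    using assms unfolding densely_dist_chaotic_def dist_scrambled_def by blast
  \<comment> \<open>Uncountability of \<open>K\<close> rules out the zero space; a nonzero vector is
    what shows that a ball remains nonempty after deleting \<open>y\<close>.\<close>
  obtain v :: 'a where v: "v \<noteq> 0"
  proof (cases "K \<subseteq> {0}")
    case True
    then show ?thesis
      using K(2) countable_subset[of K "{0}"] by simp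
  qed (use that in blast)
  obtain y where y: "y \<in> ball 0 \<epsilon>" "y \<in> K"
    using dense_meets_open[OF K(1), of "ball 0 \<epsilon>"] \<open>\<epsilon> > 0\<close> by auto
  have "ball u \<epsilon> - {y} \<noteq> {}"
  proof (cases "u = y")
    case True
    have "u + (\<epsilon> / (2 * norm v)) *\<^sub>R v \<in> ball u \<epsilon> - {y}"
      using v True \<open>\<epsilon> > 0\<close> by (simp add: dist_norm)
    then show ?thesis
      by blast
  next
    case False
    then have "u \<in> ball u \<epsilon> - {y}"
      using \<open>\<epsilon> > 0\<close> by simp
    then show ?thesis
      by blast
  qed
  then obtain x where "x \<in> ball u \<epsilon> - {y}" "x \<in> K"
    using dense_meets_open[OF K(1) open_delete[OF open_ball]] by blast
  with y K(3) show "\<exists>x y. x \<noteq> y \<and> x \<in> ball u \<epsilon> \<and> y \<in> ball 0 \<epsilon> \<and> dist_chaotic_pair \<alpha> T x y"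
    by blast
qed

text \<open>Separability gives countably many balls, centred in a countable dense set with radii
  \<open>1 / real (Suc k)\<close>. A scrambled set with a point in each of them is dense.\<close>

lemma generic_imp_densely_chaotic:
  assumes generically_irregular and "separable_space (euclidean :: 'a topology)"
  shows "densely_dist_chaotic \<alpha> T"
proof -
  obtain C :: "'a set" where C: "countable C" "closure C = UNIV"
    using assms(2) by (auto simp: separable_space_def)
  then have "C \<noteq> {}"
    by auto
  define U where "U j = (case prod_decode j of (i, k) \<Rightarrow> ball (from_nat_into C i) (1 / real (Suc k)))" for j
  have U: "U (prod_encode (i, k)) = ball (from_nat_into C i) (1 / real (Suc k))" for i k
    by (simp add: U_def)
  have "open (U j)" "U j \<noteq> {}" for j
    by (auto simp: U_def split: prod.splits)
  from generic_imp_cantor_scrambled[OF assms(1), of U, OF this]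
  obtain K where K: "\<forall>j. cantor_set (K j) \<and> K j \<subseteq> U j" "dist_scrambled \<alpha> T (\<Union>j. K j)"
    by blast
  have "\<exists>x\<in>\<Union>j. K j. dist x u < \<epsilon>" if pos: "\<epsilon> > 0" for u \<epsilon>
  proof -
    have "u \<in> closure C"
      using C(2) by simp
    then obtain c where c: "c \<in> C" "dist c u < \<epsilon> / 2"
      using half_gt_zero[OF pos] unfolding closure_approachable by blast
    then obtain i where i: "from_nat_into C i = c"
      using C(1) from_nat_into_surj by metis
    obtain k where k: "1 / real (Suc k) < \<epsilon> / 2"
      using nat_approx_posE[OF half_gt_zero[OF pos]] by blast
    let ?j = "prod_encode (i, k)"
    obtain x where x: "x \<in> K ?j"
      using uncountable_cantor_set[OF K(1)[rule_format, THEN conjunct1], of ?j] by (cases "K ?j = {}") auto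
    then have "x \<in> U ?j"
      using K(1) by blast
    then have "dist c x < 1 / real (Suc k)"
      unfolding U i by simp
    then have "dist x u < \<epsilon>"
      using c(2) k dist_triangle3[of x u c] by linarith
    then show ?thesis
      using x by blast
  qed
  then have "closure (\<Union>j. K j) = UNIV"
    by (auto simp: closure_approachable)
  with K(2) show ?thesis
    unfolding densely_dist_chaotic_def by blast
qed

end

theorem theorem3p12:
  fixes \<alpha> :: real and T :: "complex \<Rightarrow> 'a \<Rightarrow> 'a::banach"
  assumes "0 < \<alpha>" and "\<alpha> < pi / 2"
    and "C0_semigroup \<alpha> T"
  shows
    "((\<exists>S. closure S = UNIV \<and> (\<forall>x\<in>S. dist_semi_irregular \<alpha> T x)) \<longleftrightarrow>
        (\<exists>S. residual S \<and> (\<forall>x\<in>S. dist_irregular \<alpha> T x))) \<and>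
     ((\<exists>S. closure S = UNIV \<and> (\<forall>x\<in>S. dist_semi_irregular \<alpha> T x)) \<longleftrightarrow>
        closure (DProx \<alpha> T) = UNIV \<and> dist_sensitive \<alpha> T) \<and>
     ((\<exists>S. closure S = UNIV \<and> (\<forall>x\<in>S. dist_semi_irregular \<alpha> T x)) \<longleftrightarrow>
        (\<forall>U :: nat \<Rightarrow> 'a set. (\<forall>j. open (U j) \<and> U j \<noteq> {}) \<longrightarrow>
          (\<exists>K :: nat \<Rightarrow> 'a set. (\<forall>j. cantor_set (K j) \<and> K j \<subseteq> U j) \<and>
             dist_scrambled \<alpha> T (\<Union>j. K j)))) \<and>
     (separable_space (euclidean :: 'a topology) \<longrightarrow>
        ((\<exists>S. closure S = UNIV \<and> (\<forall>x\<in>S. dist_semi_irregular \<alpha> T x)) \<longleftrightarrow>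
           densely_dist_chaotic \<alpha> T))"
proof -
  interpret C0_sector \<alpha> T
    by unfold_locales (rule assms)+
  have dense: "(\<exists>S. closure S = UNIV \<and> (\<forall>x\<in>S. dist_semi_irregular \<alpha> T x)) \<longleftrightarrow>
      closure {x. dist_semi_irregular \<alpha> T x} = UNIV"
    using closure_mono_UNIV[of _ "{x. dist_semi_irregular \<alpha> T x}"] by blast
  \<comment> \<open>Closes the cycle from dense semi-irregularity through genericity and residuality
    back, so that genericity can replace the first assertion in all equivalences.\<close>
  have generic: "closure {x. dist_semi_irregular \<alpha> T x} = UNIV \<longleftrightarrow> generically_irregular"
    using dense_semi_imp_generic generic_imp_residual residual_imp_dense_semi by blast
  show ?thesis
    unfolding dense generic
  proof (intro conjI impI)
    show "generically_irregular \<longleftrightarrow> (\<exists>S. residual S \<and> (\<forall>x\<in>S. dist_irregular \<alpha> T x))"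
      using generic generic_imp_residual residual_imp_dense_semi by blast
    show "generically_irregular \<longleftrightarrow> closure (DProx \<alpha> T) = UNIV \<and> dist_sensitive \<alpha> T"
      using generic_imp_prox_sensitive prox_sensitive_imp_generic by blast
    show "generically_irregular \<longleftrightarrow> (\<forall>U :: nat \<Rightarrow> 'a set. (\<forall>j. open (U j) \<and> U j \<noteq> {}) \<longrightarrow>
        (\<exists>K :: nat \<Rightarrow> 'a set. (\<forall>j. cantor_set (K j) \<and> K j \<subseteq> U j) \<and> dist_scrambled \<alpha> T (\<Union>j. K j)))"
      using generic generic_imp_cantor_scrambled cantor_scrambled_imp_dense_semi by auto
    show "generically_irregular \<longleftrightarrow> densely_dist_chaotic \<alpha> T" if "separable_space (euclidean :: 'a topology)"
      using generic generic_imp_densely_chaotic[OF _ that] densely_chaotic_imp_dense_semi by blast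
  qed
qed

end
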